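(* Let $f$ be a regular function on a symmetric slice domain $\Omega\subseteq\mathbb{H}$, and let $x_0,y_0\in\mathbb{R}$ and $R>0$ be such that $U(x_0+y_0\mathbb{S},R)\subseteq\Omega$. For all $q_0\in x_0+y_0\mathbb{S}$, setting $A_{2n}=(R_{\bar q_0}R_{q_0})^nf(q_0)$ and $A_{2n+1}=R_{q_0}(R_{\bar q_0}R_{q_0})^nf(\bar q_0)$ for $n\in\mathbb{N}$, we have $$f(q)=\sum_{n\in\mathbb{N}}[(q-x_0)^2+y_0^2]^n\,[A_{2n}+(q-q_0)A_{2n+1}]$$ for all $q\in U(x_0+y_0\mathbb{S},R)$.
   Context: $\mathbb{H}$ is the real algebra of quaternions with conjugation $q\mapsto\bar q$ and modulus $|\cdot|$; $\mathbb{N}=\{0,1,2,\dots\}$; $\mathbb{S}=\{q\in\mathbb{H}:q^2=-1\}$; for $I\in\mathbb{S}$, $L_I=\mathbb{R}+I\mathbb{R}\simeq\mathbb{C}$; $x_0+y_0\mathbb{S}=\{x_0+y_0J:J\in\mathbb{S}\}$; and $U(x_0+y_0\mathbb{S},R)=\{q\in\mathbb{H}:|(q-x_0)^2+y_0^2|<R^2\}$. For a domain (connected open set) $\Omega\subseteq\mathbb{H}$ and $f:\Omega\to\mathbb{H}$, put $\Omega_I=\Omega\cap L_I$, $f_I=f|_{\Omega_I}$. The function $f$ is (slice) regular if for every $I\in\mathbb{S}$ the restriction $f_I$ is holomorphic, i.e. $\frac12\left(\frac{\partial}{\partial x}+I\frac{\partial}{\partial y}\right)f_I(x+Iy)=0$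 identically on $\Omega_I$. A domain $\Omega$ is a slice domain if it intersects the real axis and $\Omega_I$ is a domain in $L_I$ for all $I\in\mathbb{S}$; it is symmetric if $x+Iy\in\Omega$ (with $x,y\in\mathbb{R}$, $I\in\mathbb{S}$) implies $x+y\mathbb{S}\subseteq\Omega$. Regular product: if $f,g$ are regular on a symmetric slice domain $\Omega$, choose $I,J\in\mathbb{S}$ with $I\perp J$ and write $f_I=F+GJ$, $g_I=H+KJ$ with $F,G,H,K:\Omega_I\to L_I$ holomorphic; $f*g$ is the unique regular function on $\Omega$ whose restriction to $\Omega_I$ is $[F(z)H(z)-G(z)\overline{K(\bar z)}]+[F(z)K(z)+G(z)\overline{H(\bar z)}]J$ (independent of the choice of $I,J$). It extends the product $\left(\sum q^na_n\right)*\left(\sum q^nb_n\right)=\sum q^n\sum_{k=0}^na_kb_{n-k}$ of power series. Operator $R_{q_0}$: for $f$ regular on a symmetric slice domain $\Omega$ and $q_0\in\Omega$, $R_{q_0}f:\Omega\to\mathbb{H}$ denotes the (unique, known to exist) regular function such that $f(q)=f(q_0)+(q-q_0)*R_{q_0}f(q)$ on $\Omega$. (If $q_0\in L_I$, then $f(z)=f(q_0)+(z-q_0)R_{q_0}f(z)$ for $z\in\Omega_I$.) $(R_{\bar q_0}R_{q_0})^n$ denotes the $n$-th iterate of $f\mapsto R_{\bar q_0}(R_{q_0}f)$. *)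

theory Defs
  imports "HOL-Analysis.Analysis"
begin

codatatype quat = Quat (qRe: real) (qIm1: real) (qIm2: real) (qIm3: real)

lemma quat_eq_iff: "p = q \<longleftrightarrow> qRe p = qRe q \<and> qIm1 p = qIm1 q \<and> qIm2 p = qIm2 q \<and> qIm3 p = qIm3 q"
  using quat.expand by blast

instantiation quat :: ab_group_add
begin

primcorec zero_quat where
  "qRe 0 = 0" | "qIm1 0 = 0" | "qIm2 0 = 0" | "qIm3 0 = 0"

primcorec plus_quat where
  "qRe (p + q) = qRe p + qRe q"
| "qIm1 (p + q) = qIm1 p + qIm1 q"
| "qIm2 (p + q) = qIm2 p + qIm2 q"
| "qIm3 (p + q) = qIm3 p + qIm3 q"

primcorec uminus_quat where
  "qRe (- p) = - qRe p"
| "qIm1 (- p) = - qIm1 p"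
| "qIm2 (- p) = - qIm2 p"
| "qIm3 (- p) = - qIm3 p"

primcorec minus_quat where
  "qRe (p - q) = qRe p - qRe q"
| "qIm1 (p - q) = qIm1 p - qIm1 q"
| "qIm2 (p - q) = qIm2 p - qIm2 q"
| "qIm3 (p - q) = qIm3 p - qIm3 q"

instance
  by standard (simp_all add: quat_eq_iff)

end

instantiation quat :: ring_1
begin

primcorec one_quat where
  "qRe 1 = 1" | "qIm1 1 = 0" | "qIm2 1 = 0" | "qIm3 1 = 0"

primcorec times_quat where
  "qRe (p * q) = qRe p * qRe q - qIm1 p * qIm1 q - qIm2 p * qIm2 q - qIm3 p * qIm3 q"
| "qIm1 (p * q) = qRe p * qIm1 q + qIm1 p * qRe q + qIm2 p * qIm3 q - qIm3 p * qIm2 q"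
| "qIm2 (p * q) = qRe p * qIm2 q - qIm1 p * qIm3 q + qIm2 p * qRe q + qIm3 p * qIm1 q"
| "qIm3 (p * q) = qRe p * qIm3 q + qIm1 p * qIm2 q - qIm2 p * qIm1 q + qIm3 p * qRe q"

instance
  by standard (simp_all add: quat_eq_iff algebra_simps)

end

instantiation quat :: real_algebra_1
begin

primcorec scaleR_quat where
  "qRe (r *\<^sub>R q) = r * qRe q"
| "qIm1 (r *\<^sub>R q) = r * qIm1 q"
| "qIm2 (r *\<^sub>R q) = r * qIm2 q"
| "qIm3 (r *\<^sub>R q) = r * qIm3 q"

instance
  by standard (simp_all add: quat_eq_iff algebra_simps)

end

instantiation quat :: real_inner
begin

definition inner_quat :: "quat \<Rightarrow> quat \<Rightarrow> real" where
  "inner_quat p q = qRe p * qRe q + qIm1 p * qIm1 q + qIm2 p * qIm2 q + qIm3 p * qIm3 q"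

definition norm_quat :: "quat \<Rightarrow> real" where
  "norm_quat q = sqrt (inner q q)"

definition sgn_quat :: "quat \<Rightarrow> quat" where
  "sgn_quat q = q /\<^sub>R norm q"

definition dist_quat :: "quat \<Rightarrow> quat \<Rightarrow> real" where
  "dist_quat p q = norm (p - q)"

definition uniformity_quat :: "(quat \<times> quat) filter" where
  "uniformity_quat = (INF e\<in>{0 <..}. principal {(p, q). dist p q < e})"

definition open_quat :: "quat set \<Rightarrow> bool" where
  "open_quat U \<longleftrightarrow> (\<forall>p\<in>U. eventually (\<lambda>(p', q). p' = p \<longrightarrow> q \<in> U) uniformity)"

instance
proof
  fix p q r :: quat and a :: real and U :: "quat set"
  show "0 \<le> inner p p"
    by (simp add: inner_quat_def)
  have "a*a + b*b + c*c + d*d = 0 \<longleftrightarrow> a = 0 \<and> b = 0 \<and> c = 0 \<and> d = 0" for a b c d :: real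
    by (simp add: add_nonneg_eq_0_iff)
  then show "inner p p = 0 \<longleftrightarrow> p = 0"
    by (simp add: inner_quat_def quat_eq_iff)
  show "inner p q = inner q p" "inner (p + q) r = inner p r + inner q r"
    "inner (a *\<^sub>R p) q = a * inner p q"
    by (simp_all add: inner_quat_def algebra_simps)
qed (rule sgn_quat_def dist_quat_def uniformity_quat_def open_quat_def norm_quat_def)+

end

primcorec qcnj :: "quat \<Rightarrow> quat" where
  "qRe (qcnj q) = qRe q"
| "qIm1 (qcnj q) = - qIm1 q"
| "qIm2 (qcnj q) = - qIm2 q"
| "qIm3 (qcnj q) = - qIm3 q"

lemma inner_self_quat: "q * qcnj q = of_real (inner q q)" "qcnj q * q = of_real (inner q q)"
  by (simp_all add: quat_eq_iff inner_quat_def of_real_def algebra_simps)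

lemma inner_mult_quat:
  fixes p q :: quat
  shows "inner (p * q) (p * q) = inner p p * inner q q"
  unfolding inner_quat_def times_quat.sel by algebra

instantiation quat :: real_normed_div_algebra
begin

definition inverse_quat :: "quat \<Rightarrow> quat" where
  "inverse_quat q = qcnj q /\<^sub>R inner q q"

definition divide_quat :: "quat \<Rightarrow> quat \<Rightarrow> quat" where
  "divide_quat p q = p * inverse q"

instance
proof
  fix p q :: quat
  show "p \<noteq> 0 \<Longrightarrow> inverse p * p = 1" "p \<noteq> 0 \<Longrightarrow> p * inverse p = 1"
    by (simp_all add: inverse_quat_def inner_self_quat of_real_def)
  show "p div q = p * inverse q"
    by (simp add: divide_quat_def)
  show "inverse (0 :: quat) = 0"
    by (simp add: inverse_quat_def)
  show "norm (p * q) = norm p * norm q"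
    by (simp add: norm_quat_def inner_mult_quat real_sqrt_mult)
qed

end

instantiation quat :: euclidean_space
begin

definition Basis_quat :: "quat set" where
  "Basis_quat = {Quat 1 0 0 0, Quat 0 1 0 0, Quat 0 0 1 0, Quat 0 0 0 1}"

instance
proof
  fix u v :: quat
  show "(Basis :: quat set) \<noteq> {}" "finite (Basis :: quat set)"
    by (simp_all add: Basis_quat_def)
  show "inner u v = (if u = v then 1 else 0)" if "u \<in> Basis" "v \<in> Basis"
    using that unfolding Basis_quat_def inner_quat_def quat_eq_iff
    by (elim insertE emptyE) simp_all
  show "(\<forall>b\<in>Basis. inner u b = 0) \<longleftrightarrow> u = 0"
    unfolding quat_eq_iff[of u 0] by (simp add: Basis_quat_def inner_quat_def)
qed

end


definition imag_units :: "quat set"  (\<open>\<SS>\<close>)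
  where "\<SS> = {q. q\<^sup>2 = - 1}"

definition slice :: "quat \<Rightarrow> quat set"
  where "slice I = {of_real x + I * of_real y | x y. True}"

definition quat_sphere :: "real \<Rightarrow> real \<Rightarrow> quat set"
  where "quat_sphere x y = {of_real x + of_real y * J | J. J \<in> \<SS>}"

definition U_nbhd :: "real \<Rightarrow> real \<Rightarrow> real \<Rightarrow> quat set"
  where "U_nbhd x0 y0 R = {q. norm ((q - of_real x0)\<^sup>2 + of_real (y0\<^sup>2)) < R\<^sup>2}"

definition slice_domain :: "quat set \<Rightarrow> bool"
  where "slice_domain \<Omega> \<longleftrightarrow>
    open \<Omega> \<and> connected \<Omega> \<and> \<Omega> \<inter> range of_real \<noteq> {} \<and>
    (\<forall>I\<in>\<SS>. openin (top_of_set (slice I)) (\<Omega> \<inter> slice I) \<and> connected (\<Omega> \<inter> slice I))"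

definition symmetric :: "quat set \<Rightarrow> bool"
  where "symmetric \<Omega> \<longleftrightarrow>
    (\<forall>x y. \<forall>I\<in>\<SS>. of_real x + I * of_real y \<in> \<Omega> \<longrightarrow> quat_sphere x y \<subseteq> \<Omega>)"

definition symmetric_slice_domain :: "quat set \<Rightarrow> bool"
  where "symmetric_slice_domain \<Omega> \<longleftrightarrow> slice_domain \<Omega> \<and> symmetric \<Omega>"


definition dbar :: "quat \<Rightarrow> (quat \<Rightarrow> quat) \<Rightarrow> real \<Rightarrow> real \<Rightarrow> quat"
  where "dbar I f x y = (1/2) *\<^sub>R
    (vector_derivative (\<lambda>t. f (of_real t + I * of_real y)) (at x) +
     I * vector_derivative (\<lambda>t. f (of_real x + I * of_real t)) (at y))"

text \<open>
  The restriction of \<open>f\<close> to \<open>\<Omega> \<inter> slice I\<close> is holomorphic: real differentiable in \<open>(x, y)\<close> (so that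
  the partial derivatives in \<^const>\<open>dbar\<close>, which are totalized, genuinely exist) and
  annihilated by \<^const>\<open>dbar\<close>. The point \<open>(x, y)\<close> is interior when \<open>\<Omega>\<close> is open, so
  only the values of \<open>f\<close> on \<open>\<Omega>\<close> matter.
\<close>

definition slice_holomorphic :: "quat \<Rightarrow> quat set \<Rightarrow> (quat \<Rightarrow> quat) \<Rightarrow> bool"
  where "slice_holomorphic I \<Omega> f \<longleftrightarrow>
    (\<forall>x y. of_real x + I * of_real y \<in> \<Omega> \<longrightarrow>
      (\<lambda>(s, t). f (of_real s + I * of_real t)) differentiable (at (x, y)) \<and> dbar I f x y = 0)"

definition regular_on :: "quat set \<Rightarrow> (quat \<Rightarrow> quat) \<Rightarrow> bool"
  where "regular_on \<Omega> f \<longleftrightarrow> (\<forall>I\<in>\<SS>. slice_holomorphic I \<Omega> f)"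


definition splitting ::
  "quat \<Rightarrow> quat \<Rightarrow> quat set \<Rightarrow> (quat \<Rightarrow> quat) \<Rightarrow> (quat \<Rightarrow> quat) \<Rightarrow> (quat \<Rightarrow> quat) \<Rightarrow> bool"
  where "splitting I J \<Omega> f F G \<longleftrightarrow>
    slice_holomorphic I \<Omega> F \<and> F \<in> (\<Omega> \<inter> slice I) \<rightarrow> slice I \<and>
    slice_holomorphic I \<Omega> G \<and> G \<in> (\<Omega> \<inter> slice I) \<rightarrow> slice I \<and>
    (\<forall>z\<in>\<Omega> \<inter> slice I. f z = F z + G z * J)"

text \<open>
  Functions on \<open>\<Omega>\<close> are total functions whose values off \<open>\<Omega>\<close> are irrelevant; membership in
  \<^term>\<open>extensional \<Omega>\<close> pins these values down, so that uniqueness on \<open>\<Omega>\<close> becomes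
  uniqueness of the total function and \<open>THE\<close> is meaningful. The regular product does
  not depend on the choice of \<open>I\<close> and \<open>J\<close>, so they may be bound existentially.
\<close>

definition is_regular_product ::
  "quat set \<Rightarrow> (quat \<Rightarrow> quat) \<Rightarrow> (quat \<Rightarrow> quat) \<Rightarrow> (quat \<Rightarrow> quat) \<Rightarrow> bool"
  where "is_regular_product \<Omega> f g h \<longleftrightarrow>
    h \<in> extensional \<Omega> \<and> regular_on \<Omega> h \<and>
    (\<exists>I\<in>\<SS>. \<exists>J\<in>\<SS>. orthogonal I J \<and>
      (\<exists>F G H K. splitting I J \<Omega> f F G \<and> splitting I J \<Omega> g H K \<and>
        (\<forall>z\<in>\<Omega> \<inter> slice I.
          h z = (F z * H z - G z * qcnj (K (qcnj z))) + (F z * K z + G z * qcnj (H (qcnj z))) * J)))"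

definition regular_product ::
  "quat set \<Rightarrow> (quat \<Rightarrow> quat) \<Rightarrow> (quat \<Rightarrow> quat) \<Rightarrow> quat \<Rightarrow> quat"
  where "regular_product \<Omega> f g = (THE h. is_regular_product \<Omega> f g h)"

definition R_op :: "quat set \<Rightarrow> quat \<Rightarrow> (quat \<Rightarrow> quat) \<Rightarrow> quat \<Rightarrow> quat"
  where "R_op \<Omega> q0 f =
    (THE g. g \<in> extensional \<Omega> \<and> regular_on \<Omega> g \<and>
      (\<forall>q\<in>\<Omega>. f q = f q0 + regular_product \<Omega> (\<lambda>p. p - q0) g q))"

definition RR_iter :: "quat set \<Rightarrow> quat \<Rightarrow> nat \<Rightarrow> (quat \<Rightarrow> quat) \<Rightarrow> quat \<Rightarrow> quat"
  where "RR_iter \<Omega> q0 n = (\<lambda>f. R_op \<Omega> (qcnj q0) (R_op \<Omega> q0 f)) ^^ n"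

end

theory Submission
  imports Defs "HOL-Complex_Analysis.Complex_Analysis"
begin

text \<open>
  The expansion is a statement about one complex variable, seen from one slice. Let
  \<open>q0 = x0 + I y0\<close>, identify \<open>slice I\<close> with the complex plane and put \<open>c = x0 + i y0\<close>. On this
  slice the regular product by \<open>q - q0\<close> is the ordinary product by \<open>z - c\<close>, so \<open>R_op\<close> is the
  difference quotient there (\<open>R_op_slice\<close>), and the two components of \<open>f\<close> along
  \<open>slice I\<close> and \<open>(slice I) J\<close>, with \<open>J\<close> a unit orthogonal to \<open>I\<close>, are holomorphic functions to which
  the same difference quotients are applied.

  For a holomorphic function \<open>F\<close> on the Cassini region \<open>|P z| < r\<close>, where
  \<open>P z = (z - a) (z - b)\<close>, the region is invariant under the half-turn that exchanges \<open>a\<close> and \<open>b\<close>,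
  and the even and odd parts of \<open>F\<close> about the midpoint are functions of \<open>P\<close>. Hence
  \<open>F z = E (P z) + (z - a) * Q (P z)\<close> with \<open>E\<close> and \<open>Q\<close> holomorphic on the disc of radius \<open>r\<close>
  (\<open>two_point_factor\<close>). Their Taylor series converge on that whole disc, which gives the
  convergence on the whole region, even when it consists of two ovals. A difference quotient at
  \<open>a\<close> followed by one at \<open>b\<close> shifts both Taylor series by one place, and this identifies the
  coefficients (\<open>two_point_expansion\<close>).

  The other slices follow from \<open>representation_formula\<close>: the values of a regular function on
  \<open>slice J\<close> are a fixed left linear combination of its values at two conjugate points of
  \<open>slice I\<close>. The partial sums satisfy the same formula.

  Since \<open>R_op\<close> and \<open>regular_product\<close> are given by unique existence, both must be shown to exist
  uniquely. For the left factor \<open>q - c\<close> the product has the closed form \<open>linear_star\<close> on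
  every slice, which shows that it is regular and does not depend on the units used to
  split the factors. The quotient is built on one slice, by removing a singularity, and carried
  to the other slices by \<open>slice_extension\<close>. Uniqueness rests on \<open>regular_identity\<close>.
\<close>

section \<open>Expansion of a holomorphic function at two points\<close>

text \<open>
  Any choice of square root \<open>s\<close> of \<open>u\<close> gives the same value \<open>\<phi> s\<close>, so away from \<open>0\<close> a local
  holomorphic branch of the root may be used; at \<open>0\<close> the root is still continuous and the
  singularity is removable.
\<close>

lemma even_holomorphic_factor:
  fixes \<phi> :: "complex \<Rightarrow> complex"
  assumes "open U" and hol: "\<phi> holomorphic_on {s. s\<^sup>2 \<in> U}"
    and even: "\<And>s. s\<^sup>2 \<in> U \<Longrightarrow> \<phi> (- s) = \<phi> s"
  obtains E where "E holomorphic_on U" "\<And>s. s\<^sup>2 \<in> U \<Longrightarrow> \<phi> s = E (s\<^sup>2)"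
proof
  let ?V = "{s. s\<^sup>2 \<in> U}" and ?E = "\<lambda>u. \<phi> (csqrt u)"
  have openV: "open ?V"
    using open_vimage[OF \<open>open U\<close>, of "\<lambda>s. s\<^sup>2"] by (simp add: vimage_def continuous_intros)
  show eq: "\<phi> s = ?E (s\<^sup>2)" if "s\<^sup>2 \<in> U" for s
  proof -
    have "csqrt (s\<^sup>2) = s \<or> csqrt (s\<^sup>2) = - s"
      by (metis power2_csqrt power2_eq_iff)
    then show ?thesis using even that by auto
  qed
  \<comment> \<open>\<open>csqrt u\<close> is holomorphic off the nonpositive reals and \<open>\<i> * csqrt (- u)\<close> off the
    nonnegative ones; both are square roots of \<open>u\<close>.\<close>
  have cut1: "?E holomorphic_on U - \<real>\<^sub>\<le>\<^sub>0"
    by (rule holomorphic_on_compose_gen[OF _ hol, unfolded o_def]) (auto intro!: holomorphic_intros)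
  have "(\<lambda>u. \<phi> (\<i> * csqrt (- u))) holomorphic_on U - \<real>\<^sub>\<ge>\<^sub>0"
    by (rule holomorphic_on_compose_gen[OF _ hol, unfolded o_def])
      (auto intro!: holomorphic_intros simp: power_mult_distrib)
  moreover have "\<phi> (\<i> * csqrt (- u)) = ?E u" if "u \<in> U" for u
    using eq[of "\<i> * csqrt (- u)"] that by (simp add: power_mult_distrib)
  ultimately have cut2: "?E holomorphic_on U - \<real>\<^sub>\<ge>\<^sub>0"
    by (subst (asm) holomorphic_cong[of "U - \<real>\<^sub>\<ge>\<^sub>0" _ _ ?E]) auto
  have "U - {0} = (U - \<real>\<^sub>\<le>\<^sub>0) \<union> (U - \<real>\<^sub>\<ge>\<^sub>0)"
    by (auto simp: complex_nonpos_Reals_iff complex_nonneg_Reals_iff complex_eq_iff)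
  then have punct: "?E holomorphic_on U - {0}"
    using holomorphic_on_Un[OF cut1 cut2] \<open>open U\<close>
    by (simp add: open_Diff closed_nonpos_Reals_complex closed_nonneg_Reals_complex)
  have "isCont ?E u" if "u \<in> U" for u
  proof (cases "u = 0")
    case False
    then show ?thesis
      using punct \<open>open U\<close> that
      by (meson Diff_iff continuous_on_eq_continuous_at finite.emptyI finite.insertI
          finite_imp_closed holomorphic_on_imp_continuous_on open_Diff singletonD)
  next
    case True
    have "((\<lambda>u. norm (csqrt u)) \<longlongrightarrow> norm (csqrt 0)) (at 0)"
      unfolding norm_csqrt by (intro tendsto_intros)
    then have "(csqrt \<longlongrightarrow> csqrt 0) (at 0)"
      unfolding csqrt_0 norm_zero by (rule tendsto_norm_zero_cancel)
    then have "isCont csqrt u" using True by (simp add: isCont_def)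
    moreover have "isCont \<phi> (csqrt u)"
      using holomorphic_on_imp_continuous_on[OF hol] openV that
      by (simp add: continuous_on_eq_continuous_at)
    ultimately show ?thesis by (rule isCont_o2)
  qed
  then have "continuous_on U ?E" by (simp add: continuous_at_imp_continuous_on)
  then show "?E holomorphic_on U"
    using punct \<open>open U\<close> no_isolated_singularity by blast
qed

text \<open>
  In the coordinate \<open>s\<close> centred at the midpoint of \<open>a\<close> and \<open>b\<close> the polynomial \<open>(z - a) (z - b)\<close>
  is \<open>s\<^sup>2 - \<delta>\<close>, so that \<open>even_holomorphic_factor\<close> applies to the even part of \<open>F\<close> and to its
  odd part divided by \<open>s\<close>.
\<close>

lemma two_point_factor:
  fixes F :: "complex \<Rightarrow> complex" and a b :: complex and r :: real
  assumes hol: "F holomorphic_on {z. norm ((z - a) * (z - b)) < r}"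
  obtains E Q where "E holomorphic_on ball 0 r" "Q holomorphic_on ball 0 r"
    "\<And>z. norm ((z - a) * (z - b)) < r \<Longrightarrow>
       F z = E ((z - a) * (z - b)) + (z - a) * Q ((z - a) * (z - b))"
proof -
  define m \<delta> where "m = (a + b) / 2" and "\<delta> = ((a - b) / 2)\<^sup>2"
  let ?V = "{s. s\<^sup>2 \<in> ball \<delta> r}"
  have P: "(m + s - a) * (m + s - b) = s\<^sup>2 - \<delta>" for s
    by (simp add: m_def \<delta>_def field_simps power2_eq_square)
  have mem: "s\<^sup>2 \<in> ball \<delta> r \<longleftrightarrow> norm ((m + s - a) * (m + s - b)) < r" for s
    unfolding P by (simp add: dist_norm norm_minus_commute)
  have openV: "open ?V"
    using open_vimage[of "ball \<delta> r" "\<lambda>s. s\<^sup>2"] by (simp add: vimage_def continuous_intros)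
  have hol1: "(\<lambda>s. F (m + s)) holomorphic_on ?V"
    by (rule holomorphic_on_compose_gen[OF _ hol, unfolded o_def])
      (auto intro!: holomorphic_intros simp: mem simp del: mem_ball)
  have hol2: "(\<lambda>s. F (m - s)) holomorphic_on ?V"
  proof (rule holomorphic_on_compose_gen[OF _ hol, unfolded o_def])
    show "(\<lambda>s. m - s) ` ?V \<subseteq> {z. norm ((z - a) * (z - b)) < r}"
      using mem[of "- s" for s] by auto
  qed (auto intro!: holomorphic_intros)
  define e h where "e s = (F (m + s) + F (m - s)) / 2" and "h s = (F (m + s) - F (m - s)) / 2" for s
  have e: "e holomorphic_on ?V" and h: "h holomorphic_on ?V"
    unfolding e_def h_def using hol1 hol2 by (auto intro!: holomorphic_intros)
  define k where "k s = (if s = 0 then deriv h 0 else (h s - h 0) / (s - 0))" for s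
  have k: "k holomorphic_on ?V"
  proof (cases "0 \<in> ?V")
    case True
    then show ?thesis
      unfolding k_def using openV by (intro pole_lemma h) (simp add: interior_open)
  next
    case False
    have "(\<lambda>s. (h s - h 0) / (s - 0)) holomorphic_on ?V"
      using False by (intro holomorphic_intros h) auto
    then show ?thesis
      by (rule holomorphic_transform) (use False in \<open>auto simp: k_def\<close>)
  qed
  have h0: "h 0 = 0" by (simp add: h_def)
  have kh: "s * k s = h s" for s by (simp add: k_def h0)
  obtain E where E: "E holomorphic_on ball \<delta> r" "\<And>s. s\<^sup>2 \<in> ball \<delta> r \<Longrightarrow> e s = E (s\<^sup>2)"
    by (rule even_holomorphic_factor[OF _ e]) (auto simp: e_def add.commute)
  have odd: "h (- s) = - h s" for s by (simp add: h_def field_simps)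
  have "k (- s) = k s" for s by (simp add: k_def h0 odd)
  then obtain Q where Q: "Q holomorphic_on ball \<delta> r" "\<And>s. s\<^sup>2 \<in> ball \<delta> r \<Longrightarrow> k s = Q (s\<^sup>2)"
    by (metis even_holomorphic_factor[OF _ k] open_ball)
  have shift: "(\<lambda>w. G (w + \<delta>)) holomorphic_on ball 0 r" if "G holomorphic_on ball \<delta> r" for G
    by (rule holomorphic_on_compose_gen[OF _ that, unfolded o_def])
      (auto intro!: holomorphic_intros simp: dist_norm norm_minus_commute)
  \<comment> \<open>The parts are centred at \<open>m\<close>; from \<open>z - m = (z - a) - (m - a)\<close> the last
    term moves a multiple of \<open>Q\<close> into the first function.\<close>
  show thesis
  proof (rule that[of "\<lambda>w. E (w + \<delta>) - (m - a) * Q (w + \<delta>)" "\<lambda>w. Q (w + \<delta>)"])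
    fix z assume z: "norm ((z - a) * (z - b)) < r"
    define s where "s = z - m"
    have zs: "z = m + s" by (simp add: s_def)
    have s: "s\<^sup>2 \<in> ball \<delta> r" using z mem[of s] zs by simp
    have "F z = e s + h s" by (simp add: e_def h_def zs field_simps)
    also have "\<dots> = E (s\<^sup>2) + s * Q (s\<^sup>2)"
      using E(2)[OF s] Q(2)[OF s] kh[of s] by simp
    finally have "F z = E (s\<^sup>2) + s * Q (s\<^sup>2)" .
    moreover have "(z - a) * (z - b) + \<delta> = s\<^sup>2" using P[of s] zs by simp
    ultimately show "F z = E ((z - a) * (z - b) + \<delta>) - (m - a) * Q ((z - a) * (z - b) + \<delta>) +
         (z - a) * Q ((z - a) * (z - b) + \<delta>)"
      by (simp add: zs algebra_simps)
  qed (auto intro!: holomorphic_intros shift E Q)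
qed

text \<open>
  Cancelling \<open>z - a\<close> in an identity loses the point \<open>a\<close>; continuity recovers it.
\<close>

lemma continuous_on_eq_at_point:
  fixes f g :: "'a::{perfect_space,t2_space} \<Rightarrow> 'b::t2_space"
  assumes "open S" "continuous_on S f" "continuous_on S g"
    and eq: "\<And>x. x \<in> S \<Longrightarrow> x \<noteq> a \<Longrightarrow> f x = g x" and "x \<in> S"
  shows "f x = g x"
proof (cases "x = a")
  case True
  have "isCont f a" "isCont g a"
    using continuous_on_interior[of S] assms(1-3,5) True by (simp_all add: interior_open)
  then have "f \<midarrow>a\<rightarrow> f a" "g \<midarrow>a\<rightarrow> g a"
    by (simp_all add: isContD)
  moreover have "\<forall>\<^sub>F y in at a. f y = g y"
    using eventually_at_in_open[OF \<open>open S\<close>, of a] \<open>x \<in> S\<close> True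
    by (auto elim!: eventually_mono intro: eq)
  ultimately show ?thesis
    using True tendsto_unique[of "at a" g "f a" "g a"] by (auto simp: tendsto_cong)
qed (use assms in auto)

lemma power_series_tail:
  fixes e :: "nat \<Rightarrow> complex"
  assumes sm: "\<And>w. norm w < r \<Longrightarrow> summable (\<lambda>k. e k * w ^ k)"
  defines "T \<equiv> \<lambda>n w. \<Sum>k. e (k + n) * w ^ k"
  shows "T n holomorphic_on ball 0 r" and "T n 0 = e n"
    and "norm w < r \<Longrightarrow> T n w = e n + w * T (Suc n) w"
proof -
  have sm': "summable (\<lambda>k. e (k + n) * w ^ k)" if "norm w < r" for w n
  proof (cases "w = 0")
    case False
    have "summable (\<lambda>k. e (k + n) * w ^ (k + n) * inverse (w ^ n))"
      using sm[OF that] by (intro summable_mult2) (rule summable_ignore_initial_segment)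
    then show ?thesis using False by (simp add: power_add field_simps)
  qed (simp add: summable_finite[of "{0}"])
  show "T n holomorphic_on ball 0 r"
    unfolding T_def using summable_sums[OF sm']
    by (intro power_series_holomorphic[where a = "\<lambda>k. e (k + n)"]) simp
  show "T n 0 = e n" unfolding T_def by (simp)
  assume w: "norm w < r"
  have "T n w = e n + (\<Sum>k. e (Suc k + n) * w ^ Suc k)"
    unfolding T_def using suminf_split_head[OF sm'[OF w, of n]] by simp
  also have "(\<Sum>k. e (Suc k + n) * w ^ Suc k) = w * T (Suc n) w"
    unfolding T_def using suminf_mult[OF sm'[OF w, of "Suc n"], of w] by (simp add: algebra_simps)
  finally show "T n w = e n + w * T (Suc n) w" .
qed

text \<open>
  The functions \<open>F n\<close> and \<open>G n\<close> are successive difference quotients, at \<open>a\<close> and \<open>b\<close> alternately.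
  If \<open>F 0 = E \<circ> P + (z - a) (Q \<circ> P)\<close>, then \<open>F n\<close> has the same form with \<open>E\<close> and \<open>Q\<close> replaced
  by their \<open>n\<close>-th Taylor tails. As \<open>P\<close> vanishes at \<open>a\<close> and \<open>b\<close>, the values \<open>F n a\<close> and \<open>G n b\<close>
  are the \<open>n\<close>-th Taylor coefficients of \<open>E\<close> and \<open>Q\<close>.
\<close>

lemma two_point_expansion:
  fixes F G :: "nat \<Rightarrow> complex \<Rightarrow> complex" and a b :: complex and r :: real
  defines "V \<equiv> {z. norm ((z - a) * (z - b)) < r}"
  assumes hol: "F 0 holomorphic_on V"
    and contF: "\<And>n. continuous_on V (F n)" and contG: "\<And>n. continuous_on V (G n)"
    and FG: "\<And>n z. z \<in> V \<Longrightarrow> F n z = F n a + (z - a) * G n z"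
    and GF: "\<And>n z. z \<in> V \<Longrightarrow> G n z = G n b + (z - b) * F (Suc n) z"
    and z: "z \<in> V"
  shows "(\<lambda>n. ((z - a) * (z - b)) ^ n * (F n a + (z - a) * G n b)) sums F 0 z"
proof -
  define P where "P z = (z - a) * (z - b)" for z
  have V: "z \<in> V \<longleftrightarrow> norm (P z) < r" for z by (simp add: V_def P_def)
  have "0 < r" using z V[of z] norm_ge_zero le_less_trans by blast
  then have abV: "a \<in> V" "b \<in> V" by (simp_all add: V P_def)
  have openV: "open V"
    unfolding V_def by (intro open_Collect_less continuous_intros)
  obtain E Q where E: "E holomorphic_on ball 0 r" and Q: "Q holomorphic_on ball 0 r"
    and EQ: "\<And>z. z \<in> V \<Longrightarrow> F 0 z = E (P z) + (z - a) * Q (P z)"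
    using two_point_factor[OF hol[unfolded V_def]] unfolding V P_def by metis
  define e q where "e n = (deriv ^^ n) E 0 / fact n" and "q n = (deriv ^^ n) Q 0 / fact n" for n
  have e: "(\<lambda>k. e k * w ^ k) sums E w" and q: "(\<lambda>k. q k * w ^ k) sums Q w" if "norm w < r" for w
    using holomorphic_power_series[OF E, of w] holomorphic_power_series[OF Q, of w] that
    by (simp_all add: e_def q_def)
  define En Qn where "En n w = (\<Sum>k. e (k + n) * w ^ k)" and "Qn n w = (\<Sum>k. q (k + n) * w ^ k)"
    for n w
  note tailE = power_series_tail[of r e, folded En_def, OF sums_summable[OF e]]
  note tailQ = power_series_tail[of r q, folded Qn_def, OF sums_summable[OF q]]
  have cont: "continuous_on V (\<lambda>z. T (P z))" if "T holomorphic_on ball 0 r" for T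
    by (rule continuous_on_compose2[OF holomorphic_on_imp_continuous_on[OF that]])
      (auto simp: V P_def intro!: continuous_intros)
  note cont' = cont[OF tailE(1)] cont[OF tailQ(1)]
  have G: "G n z = (z - b) * En (Suc n) (P z) + Qn n (P z)"
    if IH: "\<And>z. z \<in> V \<Longrightarrow> F n z = En n (P z) + (z - a) * Qn n (P z)" and z: "z \<in> V" for n z
  proof (rule continuous_on_eq_at_point[OF openV contG _ _ z, where a = a])
    fix z assume z: "z \<in> V" "z \<noteq> a"
    have "(z - a) * G n z = En n (P z) + (z - a) * Qn n (P z) - e n"
      using FG[OF z(1), of n] IH[OF z(1)] IH[OF abV(1)] by (simp add: P_def tailE(2))
    also have "\<dots> = (z - a) * ((z - b) * En (Suc n) (P z) + Qn n (P z))"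
      using tailE(3)[of "P z" n] z V by (simp add: P_def algebra_simps)
    finally show "G n z = (z - b) * En (Suc n) (P z) + Qn n (P z)"
      using z by simp
  qed (intro continuous_intros cont')
  have F: "F n z = En n (P z) + (z - a) * Qn n (P z)" if "z \<in> V" for n z
    using that
  proof (induction n arbitrary: z)
    case 0
    have "En 0 w = E w" "Qn 0 w = Q w" if "norm w < r" for w
      using e[OF that] q[OF that] by (simp_all add: En_def Qn_def sums_iff)
    then show ?case using EQ[OF 0] V[of z] 0 by simp
  next
    case (Suc n)
    have G: "G n z = (z - b) * En (Suc n) (P z) + Qn n (P z)" if "z \<in> V" for z
      by (rule G[OF Suc.IH that])
    show ?case
    proof (rule continuous_on_eq_at_point[OF openV contF _ _ Suc.prems, where a = b])
      fix z assume z: "z \<in> V" "z \<noteq> b"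
      have "(z - b) * F (Suc n) z = (z - b) * En (Suc n) (P z) + Qn n (P z) - q n"
        using GF[OF z(1), of n] G[OF z(1)] G[OF abV(2)] by (simp add: P_def tailQ(2))
      also have "\<dots> = (z - b) * (En (Suc n) (P z) + (z - a) * Qn (Suc n) (P z))"
        using tailQ(3)[of "P z" n] z V by (simp add: P_def algebra_simps)
      finally show "F (Suc n) z = En (Suc n) (P z) + (z - a) * Qn (Suc n) (P z)"
        using z by simp
    qed (intro continuous_intros cont')
  qed
  have Fa: "F n a = e n" for n using F[OF abV(1)] by (simp add: P_def tailE(2))
  have Gb: "G n b = q n" for n using G[OF F abV(2)] by (simp add: P_def tailQ(2))
  have "(\<lambda>n. e n * P z ^ n + (z - a) * (q n * P z ^ n)) sums (E (P z) + (z - a) * Q (P z))"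
    using z V by (intro sums_add sums_mult e q) auto
  then show ?thesis
    unfolding Fa Gb EQ[OF z] P_def[symmetric] by (simp add: algebra_simps)
qed

section \<open>Slices as complex planes\<close>

lemma imag_units_components:
  assumes "I \<in> \<SS>"
  shows "qRe I = 0" "qIm1 I * qIm1 I + qIm2 I * qIm2 I + qIm3 I * qIm3 I = 1"
proof -
  have *: "qRe (I * I) = - 1" "qIm1 (I * I) = 0" "qIm2 (I * I) = 0" "qIm3 (I * I) = 0"
    using assms by (simp_all add: imag_units_def power2_eq_square)
  show "qRe I = 0"
  proof (rule ccontr)
    assume "qRe I \<noteq> 0"
    with * have "qIm1 I = 0" "qIm2 I = 0" "qIm3 I = 0" by auto
    with *(1) have "qRe I * qRe I = - 1" by simp
    then show False using zero_le_square[of "qRe I"] by linarith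
  qed
  then show "qIm1 I * qIm1 I + qIm2 I * qIm2 I + qIm3 I * qIm3 I = 1"
    using *(1) by simp
qed

lemma imag_units_if_components:
  assumes "qRe I = 0" "qIm1 I * qIm1 I + qIm2 I * qIm2 I + qIm3 I * qIm3 I = 1"
  shows "I \<in> \<SS>"
  using assms by (simp add: imag_units_def power2_eq_square quat_eq_iff algebra_simps)

lemma imag_unit_square: "I \<in> \<SS> \<Longrightarrow> I * I = - 1"
  by (simp add: imag_units_def power2_eq_square)

lemma imag_unit_square_assoc: "I \<in> \<SS> \<Longrightarrow> I * (I * q) = - q"
  by (simp add: imag_unit_square flip: mult.assoc)

lemma uminus_imag_unit: "I \<in> \<SS> \<Longrightarrow> - I \<in> \<SS>"
  by (simp add: imag_units_def)

lemma norm_imag_unit: "I \<in> \<SS> \<Longrightarrow> norm I = 1"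
  using imag_units_components[of I] by (simp add: norm_quat_def inner_quat_def)

lemma orthogonal_units_anticommute:
  assumes "I \<in> \<SS>" "J \<in> \<SS>" "orthogonal I J"
  shows "J * I = - (I * J)"
  using assms imag_units_components[of I] imag_units_components[of J]
  by (simp add: quat_eq_iff orthogonal_def inner_quat_def)

lemma orthogonal_unit_exists:
  assumes "I \<in> \<SS>"
  obtains J where "J \<in> \<SS>" "orthogonal I J"
proof (cases "qIm1 I = 0 \<and> qIm2 I = 0")
  case True
  then show thesis
    using imag_units_components(1)[OF assms]
    by (intro that[of "Quat 0 1 0 0"] imag_units_if_components) (auto simp: orthogonal_def inner_quat_def)
next
  case False
  define s where "s = sqrt (qIm1 I * qIm1 I + qIm2 I * qIm2 I)"
  have "qIm1 I * qIm1 I + qIm2 I * qIm2 I > 0"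
    using False by (metis add_pos_nonneg add_nonneg_pos zero_le_square not_real_square_gt_zero)
  then have s: "s > 0" "s * s = qIm1 I * qIm1 I + qIm2 I * qIm2 I"
    unfolding s_def by (simp_all only: real_sqrt_gt_zero real_sqrt_mult_self abs_of_pos)
  show thesis
  proof (rule that[of "Quat 0 (- qIm2 I / s) (qIm1 I / s) 0"])
    show "Quat 0 (- qIm2 I / s) (qIm1 I / s) 0 \<in> \<SS>"
      using s by (intro imag_units_if_components) (auto simp: add_divide_distrib[symmetric])
  qed (simp add: orthogonal_def inner_quat_def)
qed

definition emb :: "quat \<Rightarrow> complex \<Rightarrow> quat"
  where "emb I z = of_real (Re z) + I * of_real (Im z)"

lemma emb_altdef: "emb I z = Re z *\<^sub>R 1 + Im z *\<^sub>R I"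
  by (simp add: emb_def of_real_def)

lemma bounded_linear_emb: "bounded_linear (emb I)"
  unfolding emb_altdef[abs_def]
  by (intro bounded_linear_add bounded_linear_scaleR_const bounded_linear_Re bounded_linear_Im)

lemma emb_simps:
  "emb I (z + w) = emb I z + emb I w" "emb I (z - w) = emb I z - emb I w"
  "emb I (- z) = - emb I z" "emb I 0 = 0" "emb I 1 = 1" "emb I (of_real x) = of_real x"
  "emb (- I) z = emb I (cnj z)" "emb I (Complex x y) = of_real x + I * of_real y"
  by (simp_all add: emb_def algebra_simps)

lemma emb_mult: "I \<in> \<SS> \<Longrightarrow> emb I (z * w) = emb I z * emb I w"
  using imag_unit_square[of I] by (simp add: emb_altdef algebra_simps)

lemma emb_power: "I \<in> \<SS> \<Longrightarrow> emb I (z ^ n) = emb I z ^ n"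
  by (induction n) (simp_all add: emb_mult emb_simps)

lemma emb_commute_unit: "I * emb I z = emb I z * I"
  by (simp add: emb_altdef algebra_simps)

lemma anticommute_emb: "J * I = - (I * J) \<Longrightarrow> J * emb I z = emb I (cnj z) * J"
  by (simp add: emb_altdef algebra_simps)

lemma qcnj_emb: "I \<in> \<SS> \<Longrightarrow> qcnj (emb I z) = emb I (cnj z)"
  using imag_units_components[of I] by (simp add: emb_altdef quat_eq_iff)

lemma norm_emb: "I \<in> \<SS> \<Longrightarrow> norm (emb I z) = norm z"
proof -
  assume I: "I \<in> \<SS>"
  have "inner (emb I z) (emb I z) = Re z * Re z + Im z * Im z"
    unfolding emb_altdef inner_quat_def scaleR_quat.sel plus_quat.sel one_quat.sel
      imag_units_components(1)[OF I] using imag_units_components(2)[OF I] by algebra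
  then show ?thesis by (simp add: norm_quat_def cmod_def power2_eq_square)
qed

lemma slice_eq: "slice I = range (emb I)"
  unfolding slice_def by (force simp: emb_def intro: rev_image_eqI[where x = "Complex _ _"])

lemma emb_cases:
  obtains J z where "J \<in> \<SS>" "q = emb J z"
proof -
  define v where "v = q - of_real (qRe q)"
  have v0: "qRe v = 0" by (simp add: v_def of_real_def)
  show thesis
  proof (cases "v = 0")
    case True
    have "Quat 0 1 0 0 \<in> \<SS>" by (rule imag_units_if_components) auto
    then show thesis
      using that[of "Quat 0 1 0 0" "of_real (qRe q)"] True by (simp add: v_def emb_simps)
  next
    case False
    have "inner v v = norm v * norm v" by (simp add: power2_norm_eq_inner[symmetric] power2_eq_square)
    then have "v /\<^sub>R norm v \<in> \<SS>"
      using False v0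
      by (intro imag_units_if_components) (auto simp: inner_quat_def field_simps)
    moreover have "q = emb (v /\<^sub>R norm v) (Complex (qRe q) (norm v))"
      using False by (simp add: emb_altdef) (simp add: v_def of_real_def)
    ultimately show thesis by (rule that)
  qed
qed

text \<open>
  The orthogonal projection of the quaternions onto \<open>slice I\<close>, read as a complex number.
\<close>

definition proj :: "quat \<Rightarrow> quat \<Rightarrow> complex"
  where "proj I q = Complex (inner 1 q) (inner I q)"

lemma bounded_linear_proj: "bounded_linear (proj I)"
proof -
  have "proj I = (\<lambda>q. of_real (inner 1 q) + of_real (inner I q) * \<i>)"
    by (simp add: fun_eq_iff proj_def complex_eq_iff)
  then show ?thesis
    by (simp add: bounded_linear_add bounded_linear_mult_const bounded_linear_of_real
        bounded_linear_inner_right bounded_linear_compose[OF bounded_linear_of_real])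
qed

text \<open>
  The projection is complex linear for multiplication by \<open>slice I\<close> on the left. It therefore turns
  holomorphic quaternion-valued functions into holomorphic complex ones.
\<close>

lemma proj_emb_mult:
  assumes "I \<in> \<SS>" shows "proj I (emb I w * q) = w * proj I q"
proof -
  have "inner I (I * q) = inner 1 q"
    using imag_units_components[OF assms] unfolding inner_quat_def times_quat.sel one_quat.sel by algebra
  moreover have "inner 1 (I * q) = - inner I q"
    using imag_units_components[OF assms] by (simp add: inner_quat_def)
  ultimately show ?thesis
    by (simp add: proj_def complex_eq_iff emb_altdef distrib_right inner_add_right algebra_simps)
qed

lemma emb_proj:
  assumes "I \<in> \<SS>" shows "emb I (proj I q) = (1/2) *\<^sub>R (q - I * q * I)"
proof -
  have "2 *\<^sub>R emb I (proj I q) = q - I * q * I"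
    unfolding quat_eq_iff emb_altdef proj_def inner_quat_def complex.sel scaleR_quat.sel
      times_quat.sel one_quat.sel plus_quat.sel minus_quat.sel imag_units_components(1)[OF assms]
    using imag_units_components(2)[OF assms] by (intro conjI; algebra)
  then show ?thesis by (metis scaleR_half_double scaleR_2 scaleR_scaleR)
qed

text \<open>
  The summands are \<open>(q - I q I) / 2\<close>, which commutes with \<open>I\<close>, and \<open>(q + I q I) / 2\<close>, which
  anticommutes with \<open>I\<close> and so lies in \<open>(slice I) J\<close>.
\<close>

lemma slice_decomposition:
  assumes I: "I \<in> \<SS>" and J: "J \<in> \<SS>" and "orthogonal I J"
  shows "q = emb I (proj I q) + emb I (- proj I (q * J)) * J"
proof -
  have JI: "J * I = - (I * J)" by (rule orthogonal_units_anticommute[OF assms])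
  have "(q * J - I * (q * J) * I) * J = - q - I * q * I"
  proof -
    have "I * (q * J) * I * J = I * q * (J * I * J)" by (simp add: mult.assoc)
    also have "J * I * J = I" 
      using imag_unit_square[OF J] by (simp add: JI mult.assoc)
    finally show ?thesis
      using imag_unit_square[OF J] by (simp add: left_diff_distrib mult.assoc)
  qed
  then have "emb I (- proj I (q * J)) * J = (1/2) *\<^sub>R (q + I * q * I)"
    unfolding emb_simps emb_proj[OF I] mult_minus_left mult_scaleR_left
    by (simp only:) (simp add: scaleR_diff_right scaleR_add_right)
  then show ?thesis
    by (simp add: emb_proj[OF I] flip: scaleR_add_right)
qed

section \<open>Holomorphic functions on a slice\<close>

text \<open>
  A quaternion-valued function of a complex variable that is holomorphic for the complex structure
  \<open>q \<mapsto> I * q\<close>: its real differential is \<open>w \<mapsto> emb I w * d\<close>. Algebraic closure properties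
  are immediate in this form, while the partial derivatives in \<^const>\<open>dbar\<close> are
  awkward to compose.
\<close>

definition left_holomorphic_on :: "quat \<Rightarrow> complex set \<Rightarrow> (complex \<Rightarrow> quat) \<Rightarrow> bool"
  where "left_holomorphic_on I D G \<longleftrightarrow>
    (\<forall>z\<in>D. \<exists>d. (G has_derivative (\<lambda>w. emb I w * d)) (at z))"

text \<open>
  The Cauchy-Riemann equation says that the differential, which is determined by its values on \<open>1\<close>
  and \<open>\<i>\<close>, sends \<open>\<i>\<close> to \<open>I\<close> times the image of \<open>1\<close>.
\<close>

lemma slice_holomorphic_iff:
  assumes I: "I \<in> \<SS>"
  shows "slice_holomorphic I \<Omega> f \<longleftrightarrow> left_holomorphic_on I (emb I -` \<Omega>) (f \<circ> emb I)"
proof -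
  let ?h = "\<lambda>(s, t). f (of_real s + I * of_real t)"
  have "(?h differentiable (at (x, y)) \<and> dbar I f x y = 0) \<longleftrightarrow>
      (\<exists>d. ((f \<circ> emb I) has_derivative (\<lambda>w. emb I w * d)) (at (Complex x y)))" (is "?L \<longleftrightarrow> ?R")
    for x y
  proof
    assume L: ?L
    then obtain D where D: "(?h has_derivative D) (at (x, y))"
      by (auto simp: differentiable_def)
    interpret D: bounded_linear D using D by (rule has_derivative_bounded_linear)
    have "((?h \<circ> (\<lambda>s. (s, y))) has_derivative (D \<circ> (\<lambda>s. (s, 0)))) (at x)"
      by (rule diff_chain_at[OF has_derivative_Pair[OF has_derivative_ident has_derivative_const] D])
    moreover have "D \<circ> (\<lambda>s. (s, 0)) = (\<lambda>s. s *\<^sub>R D (1, 0))"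
      by (simp add: fun_eq_iff flip: D.scaleR)
    ultimately have dx: "((\<lambda>s. f (of_real s + I * of_real y)) has_vector_derivative D (1, 0)) (at x)"
      by (simp add: has_vector_derivative_def) (simp add: o_def)
    have "((?h \<circ> (\<lambda>s. (x, s))) has_derivative (D \<circ> (\<lambda>s. (0, s)))) (at y)"
      by (rule diff_chain_at[OF has_derivative_Pair[OF has_derivative_const has_derivative_ident] D])
    moreover have "D \<circ> (\<lambda>s. (0, s)) = (\<lambda>s. s *\<^sub>R D (0, 1))"
      by (simp add: fun_eq_iff flip: D.scaleR)
    ultimately have dy: "((\<lambda>s. f (of_real x + I * of_real s)) has_vector_derivative D (0, 1)) (at y)"
      by (simp add: has_vector_derivative_def) (simp add: o_def)
    have "D (1, 0) + I * D (0, 1) = 0"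
      using L unfolding dbar_def vector_derivative_at[OF dx] vector_derivative_at[OF dy] by simp
    then have "I * (D (1, 0) + I * D (0, 1)) = 0" by simp
    then have CR: "D (0, 1) = I * D (1, 0)"
      by (simp add: distrib_left imag_unit_square_assoc[OF I])
    have D_eq: "D (s, t) = emb I (Complex s t) * D (1, 0)" for s t
    proof -
      have "D (s, t) = D (s *\<^sub>R (1, 0) + t *\<^sub>R (0, 1))" by simp
      also have "\<dots> = s *\<^sub>R D (1, 0) + t *\<^sub>R D (0, 1)" unfolding D.add D.scaleR ..
      finally show ?thesis by (simp add: CR emb_altdef algebra_simps)
    qed
    have D': "D \<circ> (\<lambda>w. (Re w, Im w)) = (\<lambda>w. emb I w * D (1, 0))"
      using D_eq[of "Re w" "Im w" for w] unfolding o_def complex_surj by blast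
    have "((?h \<circ> (\<lambda>z. (Re z, Im z))) has_derivative (D \<circ> (\<lambda>w. (Re w, Im w)))) (at (Complex x y))"
      by (rule diff_chain_at[OF has_derivative_Pair[OF
            bounded_linear_imp_has_derivative[OF bounded_linear_Re]
            bounded_linear_imp_has_derivative[OF bounded_linear_Im]]]) (simp add: D)
    moreover have "?h \<circ> (\<lambda>z. (Re z, Im z)) = f \<circ> emb I" by (simp add: fun_eq_iff emb_def)
    ultimately show ?R unfolding D' by auto
  next
    assume ?R
    then obtain d where d: "((f \<circ> emb I) has_derivative (\<lambda>w. emb I w * d)) (at (Complex x y))" by auto
    have C: "((\<lambda>(s, t). Complex s t) has_derivative (\<lambda>(s, t). Complex s t)) (at (x, y))"
    proof -
      have "(\<lambda>(s, t). Complex s t) = (\<lambda>p. of_real (fst p) + of_real (snd p) * \<i>)"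
        by (auto simp: fun_eq_iff complex_eq_iff)
      then show ?thesis by (auto intro!: derivative_eq_intros)
    qed
    have "((f \<circ> emb I) \<circ> (\<lambda>(s, t). Complex s t) has_derivative
        (\<lambda>w. emb I w * d) \<circ> (\<lambda>(s, t). Complex s t)) (at (x, y))"
      by (rule diff_chain_at[OF C]) (use d in simp)
    moreover have "(f \<circ> emb I) \<circ> (\<lambda>(s, t). Complex s t) = ?h"
      by (auto simp: fun_eq_iff emb_def)
    ultimately have h: "?h differentiable (at (x, y))" by (auto simp: differentiable_def)
    have "((f \<circ> emb I) \<circ> (\<lambda>s. Complex s y) has_derivative (\<lambda>w. emb I w * d) \<circ> of_real) (at x)"
    proof (rule diff_chain_at)
      have "(\<lambda>s. Complex s y) = (\<lambda>s. of_real s + of_real y * \<i>)"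
        by (auto simp: fun_eq_iff complex_eq_iff)
      then show "((\<lambda>s. Complex s y) has_derivative of_real) (at x)"
        by (auto intro!: derivative_eq_intros)
    qed (use d in simp)
    then have dx: "((\<lambda>s. f (of_real s + I * of_real y)) has_vector_derivative d) (at x)"
      by (simp add: has_vector_derivative_def o_def emb_simps scaleR_conv_of_real)
    have "((f \<circ> emb I) \<circ> (\<lambda>s. Complex x s) has_derivative (\<lambda>w. emb I w * d) \<circ> (\<lambda>s. of_real s * \<i>)) (at y)"
    proof (rule diff_chain_at)
      have "(\<lambda>s. Complex x s) = (\<lambda>s. of_real x + of_real s * \<i>)"
        by (auto simp: fun_eq_iff complex_eq_iff)
      then show "((\<lambda>s. Complex x s) has_derivative (\<lambda>s. of_real s * \<i>)) (at y)"
        by (auto intro!: derivative_eq_intros)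
    qed (use d in simp)
    then have dy: "((\<lambda>s. f (of_real x + I * of_real s)) has_vector_derivative I * d) (at y)"
      by (simp add: has_vector_derivative_def o_def emb_altdef of_real_def)
    have "dbar I f x y = 0"
      unfolding dbar_def vector_derivative_at[OF dx] vector_derivative_at[OF dy]
      by (simp add: imag_unit_square_assoc[OF I])
    with h show ?L by simp
  qed
  moreover have "(\<forall>z. P z) \<longleftrightarrow> (\<forall>x y. P (Complex x y))" for P
    by (metis complex.exhaust)
  ultimately show ?thesis
    by (simp add: slice_holomorphic_def left_holomorphic_on_def Ball_def emb_simps)
qed

lemma left_holomorphic_onE:
  assumes "left_holomorphic_on I D G" "z \<in> D"
  obtains d where "(G has_derivative (\<lambda>w. emb I w * d)) (at z)"
  using assms unfolding left_holomorphic_on_def by blast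

lemma left_holomorphic_on_cong:
  assumes "left_holomorphic_on I D G" "open D" "\<And>z. z \<in> D \<Longrightarrow> G z = H z"
  shows "left_holomorphic_on I D H"
  unfolding left_holomorphic_on_def
proof
  fix z assume z: "z \<in> D"
  then obtain d where d: "(G has_derivative (\<lambda>w. emb I w * d)) (at z)"
    by (rule left_holomorphic_onE[OF assms(1)])
  show "\<exists>d. (H has_derivative (\<lambda>w. emb I w * d)) (at z)"
    by (intro exI, rule has_derivative_transform_within_open[OF d assms(2) z]) (rule assms(3))
qed

lemma left_holomorphic_on_add:
  assumes "left_holomorphic_on I D G" "left_holomorphic_on I D H"
  shows "left_holomorphic_on I D (\<lambda>z. G z + H z)"
  unfolding left_holomorphic_on_def
proof
  fix z assume "z \<in> D"
  then obtain d e where "(G has_derivative (\<lambda>w. emb I w * d)) (at z)"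
    "(H has_derivative (\<lambda>w. emb I w * e)) (at z)"
    using assms by (blast elim: left_holomorphic_onE)
  from has_derivative_add[OF this]
  show "\<exists>d. ((\<lambda>z. G z + H z) has_derivative (\<lambda>w. emb I w * d)) (at z)"
    by (auto simp flip: distrib_left)
qed

lemma left_holomorphic_on_mult_right:
  assumes "left_holomorphic_on I D G"
  shows "left_holomorphic_on I D (\<lambda>z. G z * c)"
  unfolding left_holomorphic_on_def
proof
  fix z assume "z \<in> D"
  then obtain d where "(G has_derivative (\<lambda>w. emb I w * d)) (at z)"
    using assms by (blast elim: left_holomorphic_onE)
  from has_derivative_mult_left[OF this, of c]
  show "\<exists>d. ((\<lambda>z. G z * c) has_derivative (\<lambda>w. emb I w * d)) (at z)"
    by (auto simp: mult.assoc)
qed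

lemma left_holomorphic_on_uminus:
  "left_holomorphic_on I D G \<Longrightarrow> left_holomorphic_on I D (\<lambda>z. - G z)"
  using left_holomorphic_on_mult_right[of I D G "- 1"] by simp

lemma left_holomorphic_on_diff:
  assumes "left_holomorphic_on I D G" "left_holomorphic_on I D H"
  shows "left_holomorphic_on I D (\<lambda>z. G z - H z)"
  using left_holomorphic_on_add[OF assms(1) left_holomorphic_on_uminus[OF assms(2)]] by simp

lemma left_holomorphic_on_const: "left_holomorphic_on I D (\<lambda>z. c)"
  unfolding left_holomorphic_on_def by (auto intro!: exI[of _ 0])

lemma left_holomorphic_on_emb: "left_holomorphic_on I D (emb I)"
  unfolding left_holomorphic_on_def
  using bounded_linear_imp_has_derivative[OF bounded_linear_emb[of I]] by (auto intro!: exI[of _ 1])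

lemma left_holomorphic_on_emb_mult:
  assumes I: "I \<in> \<SS>" and G: "left_holomorphic_on I D G"
  shows "left_holomorphic_on I D (\<lambda>z. emb I z * G z)"
  unfolding left_holomorphic_on_def
proof
  fix z assume "z \<in> D"
  then obtain d where "(G has_derivative (\<lambda>w. emb I w * d)) (at z)"
    using assms by (blast elim: left_holomorphic_onE)
  from has_derivative_mult[OF bounded_linear_imp_has_derivative[OF bounded_linear_emb[of I]] this]
  have "((\<lambda>z. emb I z * G z) has_derivative (\<lambda>w. emb I z * (emb I w * d) + emb I w * G z)) (at z)" .
  moreover have "emb I z * (emb I w * d) = emb I w * (emb I z * d)" for w
    by (metis emb_mult[OF I] mult.assoc mult.commute)
  ultimately show "\<exists>d. ((\<lambda>z. emb I z * G z) has_derivative (\<lambda>w. emb I w * d)) (at z)"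
    by (auto simp flip: distrib_left)
qed

text \<open>
  Left multiplication by \<open>\<Phi>\<close> carries the complex structure \<open>I\<close> to the complex structure \<open>J\<close>. With
  \<open>\<Phi> = 1 - J * I\<close> this moves functions between slices; with \<open>J = I\<close> it handles the part of a
  constant that commutes with \<open>I\<close>.
\<close>

lemma left_holomorphic_on_intertwine:
  assumes "J * \<Phi> = \<Phi> * I" and G: "left_holomorphic_on I D G"
  shows "left_holomorphic_on J D (\<lambda>z. \<Phi> * G z)"
  unfolding left_holomorphic_on_def
proof
  fix z assume "z \<in> D"
  then obtain d where "(G has_derivative (\<lambda>w. emb I w * d)) (at z)"
    using assms by (blast elim: left_holomorphic_onE)
  from has_derivative_mult_right[OF this, of \<Phi>]
  have "((\<lambda>z. \<Phi> * G z) has_derivative (\<lambda>w. \<Phi> * (emb I w * d))) (at z)" .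
  moreover have "\<Phi> * (emb I w * d) = emb J w * (\<Phi> * d)" for w
    using assms(1) by (simp add: emb_altdef algebra_simps flip: mult.assoc)
  ultimately show "\<exists>d. ((\<lambda>z. \<Phi> * G z) has_derivative (\<lambda>w. emb J w * d)) (at z)"
    by auto
qed

text \<open>
  Conjugating the variable reverses the complex structure. Combined with a factor that
  anticommutes with \<open>I\<close>, it gives back a holomorphic function.
\<close>

lemma left_holomorphic_on_reflect:
  assumes G: "left_holomorphic_on I D G" and D: "\<And>z. z \<in> D' \<Longrightarrow> cnj z \<in> D"
  shows "left_holomorphic_on (- I) D' (\<lambda>z. G (cnj z))"
  unfolding left_holomorphic_on_def
proof
  fix z assume "z \<in> D'"
  then obtain d where d: "(G has_derivative (\<lambda>w. emb I w * d)) (at (cnj z))"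
    using D[of z] by (blast intro: left_holomorphic_onE[OF G])
  have "((G \<circ> cnj) has_derivative ((\<lambda>w. emb I w * d) \<circ> cnj)) (at z)"
    by (rule diff_chain_at[OF bounded_linear_imp_has_derivative[OF bounded_linear_cnj] d])
  then show "\<exists>d. ((\<lambda>z. G (cnj z)) has_derivative (\<lambda>w. emb (- I) w * d)) (at z)"
    by (auto simp: o_def emb_simps)
qed

lemma left_holomorphic_on_imp_continuous_on:
  "left_holomorphic_on I D G \<Longrightarrow> continuous_on D G"
  unfolding left_holomorphic_on_def
  by (meson continuous_at_imp_continuous_on has_derivative_continuous)

lemma holomorphic_on_proj:
  assumes I: "I \<in> \<SS>" and G: "left_holomorphic_on I D G"
  shows "(\<lambda>z. proj I (G z)) holomorphic_on D"
proof -
  have "(\<lambda>z. proj I (G z)) field_differentiable (at z)" if z: "z \<in> D" for z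
  proof -
    obtain d where "(G has_derivative (\<lambda>w. emb I w * d)) (at z)"
      by (rule left_holomorphic_onE[OF G z])
    from bounded_linear.has_derivative[OF bounded_linear_proj[of I] this]
    have "((\<lambda>z. proj I (G z)) has_derivative (\<lambda>w. w * proj I d)) (at z)"
      by (simp add: proj_emb_mult[OF I])
    then show ?thesis
      by (auto simp: field_differentiable_def has_field_derivative_def mult_commute_abs)
  qed
  then show ?thesis
    by (simp add: holomorphic_on_def field_differentiable_at_within)
qed

lemma left_holomorphic_on_emb_comp:
  assumes I: "I \<in> \<SS>" and g: "g holomorphic_on D" and "open D"
  shows "left_holomorphic_on I D (\<lambda>z. emb I (g z))"
  unfolding left_holomorphic_on_def
proof
  fix z assume "z \<in> D"
  then have "(g has_derivative (\<lambda>w. deriv g z * w)) (at z)"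
    using holomorphic_derivI[OF g \<open>open D\<close>] by (simp add: has_field_derivative_def)
  from bounded_linear.has_derivative[OF bounded_linear_emb[of I] this]
  show "\<exists>d. ((\<lambda>z. emb I (g z)) has_derivative (\<lambda>w. emb I w * d)) (at z)"
    by (auto simp: emb_mult[OF I, symmetric] mult.commute intro!: exI[of _ "emb I (deriv g z)"])
qed

section \<open>Regular functions and their representation on all slices\<close>

lemma regular_on_iff:
  "regular_on \<Omega> f \<longleftrightarrow> (\<forall>I\<in>\<SS>. left_holomorphic_on I (emb I -` \<Omega>) (f \<circ> emb I))"
  by (simp add: regular_on_def slice_holomorphic_iff)

lemma open_vimage_emb: "open \<Omega> \<Longrightarrow> open (emb I -` \<Omega>)"
  by (intro open_vimage linear_continuous_on bounded_linear_emb)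

lemma regular_on_cong:
  assumes "regular_on \<Omega> f" "open \<Omega>" "\<And>q. q \<in> \<Omega> \<Longrightarrow> f q = g q"
  shows "regular_on \<Omega> g"
  unfolding regular_on_iff
proof
  fix I assume "I \<in> \<SS>"
  then have "left_holomorphic_on I (emb I -` \<Omega>) (f \<circ> emb I)"
    using assms(1) by (simp add: regular_on_iff)
  then show "left_holomorphic_on I (emb I -` \<Omega>) (g \<circ> emb I)"
    by (rule left_holomorphic_on_cong) (use assms open_vimage_emb in auto)
qed

lemma quat_sphere_eq: "quat_sphere x y = {emb J (Complex x y) | J. J \<in> \<SS>}"
  by (simp add: quat_sphere_def emb_simps of_real_def)

lemma symmetric_slice_domain_open: "symmetric_slice_domain \<Omega> \<Longrightarrow> open \<Omega>"
  by (simp add: symmetric_slice_domain_def slice_domain_def)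

lemma emb_mem_iff:
  assumes "symmetric_slice_domain \<Omega>" "I \<in> \<SS>" "J \<in> \<SS>"
  shows "emb I z \<in> \<Omega> \<longleftrightarrow> emb J z \<in> \<Omega>"
proof -
  have "emb J z \<in> \<Omega>" if "emb I z \<in> \<Omega>" "I \<in> \<SS>" "J \<in> \<SS>" for I J
  proof -
    have "quat_sphere (Re z) (Im z) \<subseteq> \<Omega>"
      using assms(1) that unfolding symmetric_slice_domain_def symmetric_def emb_def by blast
    then show ?thesis using that unfolding quat_sphere_eq by auto
  qed
  then show ?thesis using assms by blast
qed

lemma emb_cnj_mem_iff:
  assumes "symmetric_slice_domain \<Omega>" "I \<in> \<SS>"
  shows "emb I (cnj z) \<in> \<Omega> \<longleftrightarrow> emb I z \<in> \<Omega>"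
  using emb_mem_iff[OF assms(1) assms(2) uminus_imag_unit[OF assms(2)], of z] by (simp add: emb_simps)

lemma proj_emb: "I \<in> \<SS> \<Longrightarrow> proj I (emb I z) = z"
  using proj_emb_mult[of I z 1] imag_units_components(1)[of I]
  by (simp add: proj_def inner_quat_def flip: one_complex.code)

lemma connected_vimage_emb:
  assumes "symmetric_slice_domain \<Omega>" "I \<in> \<SS>"
  shows "connected (emb I -` \<Omega>)"
proof -
  have "\<Omega> \<inter> slice I = emb I ` (emb I -` \<Omega>)"
    by (auto simp: slice_eq)
  then have "emb I -` \<Omega> = proj I ` (\<Omega> \<inter> slice I)"
    by (simp only: image_image proj_emb[OF assms(2)] image_ident)
  moreover have "connected (\<Omega> \<inter> slice I)"
    using assms by (simp add: symmetric_slice_domain_def slice_domain_def)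
  ultimately show ?thesis
    by (simp add: connected_continuous_image linear_continuous_on bounded_linear_proj)
qed

text \<open>
  All slices share the real axis. Agreement on one slice gives agreement at the real points
  of \<open>\<Omega>\<close>, which accumulate in every slice, and each slice of \<open>\<Omega>\<close> is connected.
\<close>

lemma regular_identity:
  assumes ssd: "symmetric_slice_domain \<Omega>" and f: "regular_on \<Omega> f" and g: "regular_on \<Omega> g"
    and I: "I \<in> \<SS>" and eq: "\<And>z. emb I z \<in> \<Omega> \<Longrightarrow> f (emb I z) = g (emb I z)" and q: "q \<in> \<Omega>"
  shows "f q = g q"
proof -
  obtain J z where J: "J \<in> \<SS>" and qz: "q = emb J z" by (rule emb_cases)
  obtain K where K: "K \<in> \<SS>" "orthogonal J K" using orthogonal_unit_exists[OF J] by blast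
  let ?D = "emb J -` \<Omega>" and ?h = "\<lambda>z. f (emb J z) - g (emb J z)"
  have D: "open ?D" "connected ?D"
    using open_vimage_emb[OF symmetric_slice_domain_open[OF ssd]] connected_vimage_emb[OF ssd J] by auto
  have h: "left_holomorphic_on J ?D ?h"
    using left_holomorphic_on_diff[of J ?D "f \<circ> emb J" "g \<circ> emb J"] f g J
    by (simp add: regular_on_iff o_def)
  obtain x where x: "of_real x \<in> \<Omega>"
    using ssd by (auto simp: symmetric_slice_domain_def slice_domain_def)
  have real: "?h (of_real t) = 0" if "of_real t \<in> ?D" for t
    using eq[of "of_real t"] that by (simp add: emb_simps)
  have lim: "of_real x islimpt (?D \<inter> range (of_real :: real \<Rightarrow> complex))"
  proof (rule islimptI)
    fix T :: "complex set" assume T: "of_real x \<in> T" "open T"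
    have "open (of_real -` (T \<inter> ?D) :: real set)"
      using T D by (intro open_vimage continuous_intros) auto
    then obtain t where "t \<in> of_real -` (T \<inter> ?D)" "t \<noteq> x"
      using islimptE[OF islimpt_UNIV, of x "of_real -` (T \<inter> ?D)"] T x by (auto simp: emb_simps)
    then show "\<exists>y\<in>?D \<inter> range of_real. y \<in> T \<and> y \<noteq> complex_of_real x"
      by (intro bexI[of _ "of_real t"]) auto
  qed
  have zero: "p (?h z) = 0"
    if p: "bounded_linear p" "(\<lambda>z. p (?h z)) holomorphic_on ?D" for p :: "quat \<Rightarrow> complex"
  proof (rule analytic_continuation[OF p(2) D _ _ lim])
    show "p (?h w) = 0" if "w \<in> ?D \<inter> range of_real" for w
      using real that linear_0[OF bounded_linear.linear[OF p(1)]] by auto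
  qed (use x q qz in \<open>auto simp: emb_simps\<close>)
  have "proj J (?h z) = 0"
    by (rule zero[OF bounded_linear_proj holomorphic_on_proj[OF J h]])
  moreover have "proj J (?h z * K) = 0"
    by (rule zero[OF bounded_linear_compose[OF bounded_linear_proj bounded_linear_mult_left]
          holomorphic_on_proj[OF J left_holomorphic_on_mult_right[OF h]]])
  ultimately have "?h z = 0"
    using slice_decomposition[OF J K, of "?h z"] by (simp add: emb_simps)
  then show ?thesis by (simp add: qz)
qed

text \<open>
  The imaginary unit spanning the slice of \<open>q\<close>, with value \<open>0\<close> at real \<open>q\<close>. The formulas below that
  use it are symmetric under \<open>J \<mapsto> - J\<close> (together with conjugation), hence do not see the choice of
  sign, and at real points they do not depend on \<open>J\<close> at all, so that the value \<open>0\<close> is harmless.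
\<close>

definition imag_dir :: "quat \<Rightarrow> quat"
  where "imag_dir q = sgn (q - of_real (qRe q))"

lemma imag_part_emb: "J \<in> \<SS> \<Longrightarrow> emb J z - of_real (qRe (emb J z)) = Im z *\<^sub>R J"
  using imag_units_components(1)[of J] by (simp add: emb_altdef of_real_def)

lemma imag_dir_emb: "J \<in> \<SS> \<Longrightarrow> imag_dir (emb J z) = sgn (Im z) *\<^sub>R J"
  by (simp add: imag_dir_def imag_part_emb sgn_scaleR) (simp add: sgn_div_norm norm_imag_unit)

text \<open>
  The extension of a function given on \<open>slice I\<close>: the combination of the values at two
  conjugate points in which the first coefficient intertwines \<open>I\<close> with \<open>J\<close>, the second one
  \<open>- I\<close> with \<open>J\<close>, and which reduces to \<open>G z\<close> for \<open>J = I\<close>.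
\<close>

definition slice_extension :: "quat \<Rightarrow> (complex \<Rightarrow> quat) \<Rightarrow> quat \<Rightarrow> quat"
  where "slice_extension I G q =
    (let J = imag_dir q; z = Complex (qRe q) (norm (q - of_real (qRe q))) in
      (1/2) *\<^sub>R (1 - J * I) * G z + (1/2) *\<^sub>R (1 + J * I) * G (cnj z))"

lemma slice_extension_emb:
  assumes "J \<in> \<SS>"
  shows "slice_extension I G (emb J z) =
    (1/2) *\<^sub>R (1 - J * I) * G z + (1/2) *\<^sub>R (1 + J * I) * G (cnj z)"
proof -
  have re: "qRe (emb J z) = Re z"
    using imag_units_components(1)[OF assms] by (simp add: emb_altdef)
  have *: "slice_extension I G (emb J z) =
    (1/2) *\<^sub>R (1 - (sgn (Im z) *\<^sub>R J) * I) * G (Complex (Re z) \<bar>Im z\<bar>) +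
    (1/2) *\<^sub>R (1 + (sgn (Im z) *\<^sub>R J) * I) * G (cnj (Complex (Re z) \<bar>Im z\<bar>))"
    unfolding slice_extension_def Let_def imag_dir_emb[OF assms] imag_part_emb[OF assms]
    by (simp add: norm_imag_unit[OF assms] re)
  consider "Im z = 0" | "Im z > 0" | "Im z < 0" by linarith
  then show ?thesis
  proof cases
    case 1
    then have "cnj z = z" "Complex (Re z) \<bar>Im z\<bar> = z" by (simp_all add: complex_eq_iff)
    then show ?thesis unfolding * using 1
      by (simp add: algebra_simps)
  next
    case 2
    then have "Complex (Re z) \<bar>Im z\<bar> = z" by (simp add: complex_eq_iff)
    then show ?thesis unfolding * using 2 by simp
  next
    case 3
    then have "Complex (Re z) \<bar>Im z\<bar> = cnj z" by (simp add: complex_eq_iff)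
    then show ?thesis unfolding * using 3 by simp
  qed
qed

lemma slice_extension_same_slice:
  assumes "I \<in> \<SS>" shows "slice_extension I G (emb I z) = G z"
  unfolding slice_extension_emb[OF assms]
  by (simp add: imag_unit_square[OF assms] flip: scaleR_2)

lemma regular_slice_extension:
  assumes ssd: "symmetric_slice_domain \<Omega>" and I: "I \<in> \<SS>"
    and G: "left_holomorphic_on I (emb I -` \<Omega>) G"
  shows "regular_on \<Omega> (slice_extension I G)"
  unfolding regular_on_iff
proof
  fix J assume J: "J \<in> \<SS>"
  have eq: "emb J -` \<Omega> = emb I -` \<Omega>" using emb_mem_iff[OF ssd I J] by auto
  have "J * ((1/2) *\<^sub>R (1 - J * I)) = ((1/2) *\<^sub>R (1 - J * I)) * I"
    by (simp add: right_diff_distrib left_diff_distrib imag_unit_square_assoc[OF J]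
        imag_unit_square[OF I] mult.assoc add.commute)
  note 1 = left_holomorphic_on_intertwine[OF this G]
  have "left_holomorphic_on (- I) (emb I -` \<Omega>) (\<lambda>z. G (cnj z))"
    by (rule left_holomorphic_on_reflect[OF G]) (simp add: emb_cnj_mem_iff[OF ssd I])
  moreover have "J * ((1/2) *\<^sub>R (1 + J * I)) = ((1/2) *\<^sub>R (1 + J * I)) * - I"
    by (simp add: distrib_left distrib_right imag_unit_square_assoc[OF J]
        imag_unit_square[OF I] mult.assoc) (metis minus_diff_eq scaleR_minus_right)
  ultimately have 2: "left_holomorphic_on J (emb I -` \<Omega>) (\<lambda>z. (1/2) *\<^sub>R (1 + J * I) * G (cnj z))"
    by (rule left_holomorphic_on_intertwine[rotated])
  show "left_holomorphic_on J (emb J -` \<Omega>) (slice_extension I G \<circ> emb J)"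
    using left_holomorphic_on_add[OF 1 2] by (simp add: eq o_def slice_extension_emb[OF J])
qed

text \<open>
  The extension of the restriction of \<open>f\<close> to \<open>slice I\<close> is regular and agrees with \<open>f\<close> on
  \<open>slice I\<close>, so it is \<open>f\<close>.
\<close>

lemma representation_formula:
  assumes ssd: "symmetric_slice_domain \<Omega>" and f: "regular_on \<Omega> f"
    and I: "I \<in> \<SS>" and J: "J \<in> \<SS>" and z: "emb J z \<in> \<Omega>"
  shows "f (emb J z) =
    (1/2) *\<^sub>R (1 - J * I) * f (emb I z) + (1/2) *\<^sub>R (1 + J * I) * f (emb I (cnj z))"
proof -
  have "left_holomorphic_on I (emb I -` \<Omega>) (f \<circ> emb I)"
    using f I by (simp add: regular_on_iff)
  from regular_slice_extension[OF ssd I this]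
  have "f (emb J z) = slice_extension I (f \<circ> emb I) (emb J z)"
    by (rule regular_identity[OF ssd f _ I _ z]) (simp add: slice_extension_same_slice[OF I])
  then show ?thesis by (simp add: slice_extension_emb[OF J])
qed

section \<open>The regular product by a linear factor and the difference quotient\<close>

text \<open>
  The regular product of \<open>q - c\<close> with \<open>g\<close> in closed form. On the slice of \<open>J\<close> the constant \<open>c\<close>
  splits into the part \<open>(c - J c J) / 2\<close>, which commutes with \<open>J\<close> and multiplies the value of \<open>g\<close>,
  and the part \<open>(c + J c J) / 2\<close>, which anticommutes with \<open>J\<close> and multiplies the value at the
  conjugate point.
\<close>

definition linear_star :: "quat \<Rightarrow> (quat \<Rightarrow> quat) \<Rightarrow> quat \<Rightarrow> quat"
  where "linear_star c g q = (let J = imag_dir q in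
    q * g q - ((1/2) *\<^sub>R (c - J * c * J) * g q + (1/2) *\<^sub>R (c + J * c * J) * g (qcnj q)))"

lemma linear_star_emb:
  assumes "J \<in> \<SS>"
  shows "linear_star c g (emb J z) = emb J z * g (emb J z) -
    ((1/2) *\<^sub>R (c - J * c * J) * g (emb J z) + (1/2) *\<^sub>R (c + J * c * J) * g (emb J (cnj z)))"
proof (cases "Im z = 0")
  case True
  then have "cnj z = z" by (simp add: complex_eq_iff)
  then show ?thesis
    using True unfolding linear_star_def Let_def imag_dir_emb[OF assms] qcnj_emb[OF assms]
    by (simp add: algebra_simps)
next
  case False
  then have "sgn (Im z) * sgn (Im z) = 1" by (simp add: sgn_if)
  then show ?thesis
    unfolding linear_star_def Let_def imag_dir_emb[OF assms] qcnj_emb[OF assms]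
    by (simp add: mult.assoc)
qed

text \<open>
  A constant in the slice has no anticommuting part, so the product is pointwise there.
\<close>

lemma linear_star_same_slice:
  assumes I: "I \<in> \<SS>"
  shows "linear_star (emb I c) g (emb I z) = emb I (z - c) * g (emb I z)"
proof -
  have "I * emb I c * I = - emb I c"
    by (simp add: emb_commute_unit mult.assoc imag_unit_square[OF I])
  then show ?thesis
    unfolding linear_star_emb[OF I] by (simp add: emb_simps left_diff_distrib flip: scaleR_2)
qed

lemma regular_linear_star:
  assumes ssd: "symmetric_slice_domain \<Omega>" and g: "regular_on \<Omega> g"
  shows "regular_on \<Omega> (linear_star c g)"
  unfolding regular_on_iff
proof
  fix I assume I: "I \<in> \<SS>"
  let ?D = "emb I -` \<Omega>"
  have G: "left_holomorphic_on I ?D (\<lambda>z. g (emb I z))"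
    using g I by (simp add: regular_on_iff o_def)
  have "I * ((1/2) *\<^sub>R (c - I * c * I)) = ((1/2) *\<^sub>R (c - I * c * I)) * I"
    by (simp add: right_diff_distrib left_diff_distrib imag_unit_square_assoc[OF I]
        imag_unit_square[OF I] mult.assoc add.commute)
  note 1 = left_holomorphic_on_intertwine[OF this G]
  have "left_holomorphic_on (- I) ?D (\<lambda>z. g (emb I (cnj z)))"
    by (rule left_holomorphic_on_reflect[OF G]) (simp add: emb_cnj_mem_iff[OF ssd I])
  moreover have "I * ((1/2) *\<^sub>R (c + I * c * I)) = ((1/2) *\<^sub>R (c + I * c * I)) * - I"
    by (simp add: distrib_left distrib_right imag_unit_square_assoc[OF I]
        imag_unit_square[OF I] mult.assoc) (metis minus_diff_eq scaleR_minus_right)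
  ultimately have 2: "left_holomorphic_on I ?D (\<lambda>z. (1/2) *\<^sub>R (c + I * c * I) * g (emb I (cnj z)))"
    by (rule left_holomorphic_on_intertwine[rotated])
  show "left_holomorphic_on I ?D (linear_star c g \<circ> emb I)"
    using left_holomorphic_on_diff[OF left_holomorphic_on_emb_mult[OF I G] left_holomorphic_on_add[OF 1 2]]
    by (simp add: o_def linear_star_emb[OF I])
qed

text \<open>
  The formula that defines the regular product, evaluated at a point of \<open>slice I\<close>. The summands \<open>F\<close>
  and \<open>G * J\<close> of \<open>q - c\<close> commute and anticommute with \<open>I\<close>, and are thus determined by \<open>c\<close>. Moving
  \<open>J\<close> to the right past \<open>H'\<close> and \<open>K'\<close> conjugates them, so the formula is
  \<open>F * g z + G * J * g (cnj z)\<close>, with \<open>g\<close> read on the slice; this depends on \<open>I\<close>, \<open>c\<close> and \<open>g\<close> only.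
\<close>

lemma star_formula_eq_linear_star:
  assumes I: "I \<in> \<SS>" and J: "J \<in> \<SS>" and IJ: "orthogonal I J"
    and slice: "F \<in> slice I" "G \<in> slice I" "H' \<in> slice I" "K' \<in> slice I"
    and f: "emb I z - c = F + G * J"
    and g: "g (emb I z) = H + K * J" and g': "g (emb I (cnj z)) = H' + K' * J"
  shows "(F * H - G * qcnj K') + (F * K + G * qcnj H') * J = linear_star c g (emb I z)"
proof -
  have JI: "J * I = - (I * J)" by (rule orthogonal_units_anticommute[OF I J IJ])
  obtain a b h k where [simp]: "F = emb I a" "G = emb I b" "H' = emb I h" "K' = emb I k"
    using slice by (auto simp: slice_eq)
  have Jh: "J * emb I w = emb I (cnj w) * J" for w by (rule anticommute_emb[OF JI])
  have c: "c = emb I (z - a) - emb I b * J"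
    using f by (simp add: emb_simps algebra_simps)
  have IcI: "I * c * I = - emb I (z - a) - emb I b * J"
  proof -
    have "I * emb I (z - a) * I = - emb I (z - a)"
      by (simp add: emb_commute_unit mult.assoc imag_unit_square[OF I])
    moreover have "I * (emb I b * J) * I = emb I b * J"
    proof -
      have "I * (emb I b * J) * I = emb I b * (I * (J * I))"
        by (simp add: emb_commute_unit flip: mult.assoc)
      then show ?thesis by (simp add: JI imag_unit_square_assoc[OF I])
    qed
    ultimately show ?thesis by (simp add: c left_diff_distrib right_diff_distrib)
  qed
  have "c - I * c * I = 2 *\<^sub>R (emb I z - emb I a)" "c + I * c * I = 2 *\<^sub>R (- emb I b * J)"
    unfolding IcI by (simp_all add: c emb_simps scaleR_2)
  then have half: "(1/2) *\<^sub>R (c - I * c * I) = emb I z - emb I a"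
      "(1/2) *\<^sub>R (c + I * c * I) = - emb I b * J"
    by simp_all
  have "linear_star c g (emb I z) = emb I a * (H + K * J) + emb I b * J * (emb I h + emb I k * J)"
    unfolding linear_star_emb[OF I] half g g' by (simp add: algebra_simps)
  also have "emb I b * J * (emb I h + emb I k * J) = emb I b * (emb I (cnj h) * J - emb I (cnj k))"
  proof -
    have "J * (emb I k * J) = (J * emb I k) * J" by (simp only: mult.assoc)
    also have "\<dots> = - emb I (cnj k)"
      unfolding Jh by (simp add: mult.assoc imag_unit_square[OF J])
    finally show ?thesis by (simp add: mult.assoc distrib_left right_diff_distrib Jh)
  qed
  finally show ?thesis by (simp add: qcnj_emb[OF I] algebra_simps)
qed

lemma regular_splitting:
  assumes f: "regular_on \<Omega> f" and "open \<Omega>" and I: "I \<in> \<SS>" and J: "J \<in> \<SS>" "orthogonal I J"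
  shows "splitting I J \<Omega> f (\<lambda>p. emb I (proj I (f p))) (\<lambda>p. emb I (- proj I (f p * J)))"
proof -
  let ?D = "emb I -` \<Omega>"
  have D: "open ?D" by (rule open_vimage_emb) fact
  have G: "left_holomorphic_on I ?D (\<lambda>z. f (emb I z))"
    using f I by (simp add: regular_on_iff o_def)
  have "left_holomorphic_on I ?D (\<lambda>z. emb I (proj I (f (emb I z))))"
    by (intro left_holomorphic_on_emb_comp holomorphic_on_proj I G D)
  moreover have "left_holomorphic_on I ?D (\<lambda>z. emb I (- proj I (f (emb I z) * J)))"
    by (intro left_holomorphic_on_emb_comp holomorphic_on_minus holomorphic_on_proj I
        left_holomorphic_on_mult_right G D)
  ultimately show ?thesis
    using slice_decomposition[OF I J]
    by (simp add: splitting_def slice_holomorphic_iff[OF I] o_def slice_eq)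
qed

lemma regular_on_ident_minus: "regular_on \<Omega> (\<lambda>p. p - c)"
  unfolding regular_on_iff o_def
  by (intro ballI left_holomorphic_on_diff left_holomorphic_on_emb left_holomorphic_on_const)

text \<open>
  Existence holds because \<open>linear_star\<close> is regular and satisfies the defining formula.
  Uniqueness holds because any product, whatever units it comes from, agrees with \<open>linear_star\<close>
  on one slice.
\<close>

lemma regular_product_linear:
  assumes ssd: "symmetric_slice_domain \<Omega>" and g: "regular_on \<Omega> g"
  shows "regular_product \<Omega> (\<lambda>p. p - c) g = restrict (linear_star c g) \<Omega>"
proof -
  note [simp] = symmetric_slice_domain_open[OF ssd]
  have star: "(\<forall>z\<in>\<Omega> \<inter> slice I. h z =
        (F z * H z - G z * qcnj (K (qcnj z))) + (F z * K z + G z * qcnj (H (qcnj z))) * J)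
      \<longleftrightarrow> (\<forall>z. emb I z \<in> \<Omega> \<longrightarrow> h (emb I z) = linear_star c g (emb I z))"
    if IJ: "I \<in> \<SS>" "J \<in> \<SS>" "orthogonal I J"
      and s: "splitting I J \<Omega> (\<lambda>p. p - c) F G" "splitting I J \<Omega> g H K" for I J F G H K h
  proof -
    have "(F (emb I z) * H (emb I z) - G (emb I z) * qcnj (K (qcnj (emb I z)))) +
        (F (emb I z) * K (emb I z) + G (emb I z) * qcnj (H (qcnj (emb I z)))) * J
      = linear_star c g (emb I z)" if z: "emb I z \<in> \<Omega>" for z
    proof -
      have "emb I z \<in> \<Omega> \<inter> slice I" "emb I (cnj z) \<in> \<Omega> \<inter> slice I"
        using z emb_cnj_mem_iff[OF ssd IJ(1)] by (auto simp: slice_eq)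
      then show ?thesis
        using s unfolding qcnj_emb[OF IJ(1)] splitting_def
        by (intro star_formula_eq_linear_star[OF IJ]) auto
    qed
    then show ?thesis by (auto simp: slice_eq)
  qed
  show ?thesis
    unfolding regular_product_def
  proof (rule the_equality)
    show "is_regular_product \<Omega> (\<lambda>p. p - c) g (restrict (linear_star c g) \<Omega>)"
      unfolding is_regular_product_def
    proof (intro conjI)
      show "regular_on \<Omega> (restrict (linear_star c g) \<Omega>)"
        by (rule regular_on_cong[OF regular_linear_star[OF ssd g]]) simp_all
      obtain I :: quat where I: "I \<in> \<SS>" using emb_cases by blast
      obtain J where J: "J \<in> \<SS>" "orthogonal I J" using orthogonal_unit_exists[OF I] by blast
      note s = regular_splitting[OF regular_on_ident_minus _ I J, of \<Omega> c] regular_splitting[OF g _ I J]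
      show "\<exists>I\<in>\<SS>. \<exists>J\<in>\<SS>. orthogonal I J \<and>
        (\<exists>F G H K. splitting I J \<Omega> (\<lambda>p. p - c) F G \<and> splitting I J \<Omega> g H K \<and>
          (\<forall>z\<in>\<Omega> \<inter> slice I. restrict (linear_star c g) \<Omega> z =
            (F z * H z - G z * qcnj (K (qcnj z))) + (F z * K z + G z * qcnj (H (qcnj z))) * J))"
        using I J s star[OF I J s] by (intro bexI[OF _ I] bexI[OF _ J(1)] conjI exI) auto
    qed simp
  next
    fix h assume h: "is_regular_product \<Omega> (\<lambda>p. p - c) g h"
    then have ext: "h \<in> extensional \<Omega>" and reg: "regular_on \<Omega> h"
      by (auto simp: is_regular_product_def)
    obtain I J F G H K where IJ: "I \<in> \<SS>" "J \<in> \<SS>" "orthogonal I J"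
      and s: "splitting I J \<Omega> (\<lambda>p. p - c) F G" "splitting I J \<Omega> g H K"
      and "\<forall>z\<in>\<Omega> \<inter> slice I. h z =
        (F z * H z - G z * qcnj (K (qcnj z))) + (F z * K z + G z * qcnj (H (qcnj z))) * J"
      using h unfolding is_regular_product_def by blast
    then have "\<forall>z. emb I z \<in> \<Omega> \<longrightarrow> h (emb I z) = linear_star c g (emb I z)"
      using star by blast
    then have "h q = linear_star c g q" if "q \<in> \<Omega>" for q
      using regular_identity[OF ssd reg regular_linear_star[OF ssd g] IJ(1) _ that] by blast
    then show "h = restrict (linear_star c g) \<Omega>"
      by (intro extensionalityI[OF ext]) auto
  qed
qed

text \<open>
  On a slice that contains the base point, the equation that defines \<open>R_op\<close> says that it is the
  difference quotient. By the identity principle the equation on \<open>\<Omega>\<close> is equivalent to this one, so it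
  suffices to divide on the slice, componentwise, and to extend.
\<close>

lemma R_op_slice:
  assumes ssd: "symmetric_slice_domain \<Omega>" and f: "regular_on \<Omega> f"
    and I: "I \<in> \<SS>" and c: "emb I c \<in> \<Omega>"
  shows "regular_on \<Omega> (R_op \<Omega> (emb I c) f)"
    and "emb I z \<in> \<Omega> \<Longrightarrow>
      f (emb I z) = f (emb I c) + emb I (z - c) * R_op \<Omega> (emb I c) f (emb I z)"
proof -
  let ?D = "emb I -` \<Omega>"
  let ?P = "\<lambda>g. g \<in> extensional \<Omega> \<and> regular_on \<Omega> g \<and>
      (\<forall>q\<in>\<Omega>. f q = f (emb I c) + regular_product \<Omega> (\<lambda>p. p - emb I c) g q)"
  note [simp] = symmetric_slice_domain_open[OF ssd]
  have D: "open ?D" by (rule open_vimage_emb) simp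
  have P_iff: "?P g \<longleftrightarrow> g \<in> extensional \<Omega> \<and> regular_on \<Omega> g \<and>
      (\<forall>z\<in>?D. f (emb I z) = f (emb I c) + emb I (z - c) * g (emb I z))" for g
  proof -
    have "(\<forall>q\<in>\<Omega>. f q = f (emb I c) + linear_star (emb I c) g q) \<longleftrightarrow>
      (\<forall>z\<in>?D. f (emb I z) = f (emb I c) + emb I (z - c) * g (emb I z))" (is "?L \<longleftrightarrow> ?R")
      if g: "regular_on \<Omega> g"
    proof
      assume ?R
      have "left_holomorphic_on J (emb J -` \<Omega>)
          ((\<lambda>q. f (emb I c) + linear_star (emb I c) g q) \<circ> emb J)" if "J \<in> \<SS>" for J
        using left_holomorphic_on_add[OF left_holomorphic_on_const]
          regular_linear_star[OF ssd g, of "emb I c"] that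
        by (simp add: regular_on_iff o_def)
      then have "regular_on \<Omega> (\<lambda>q. f (emb I c) + linear_star (emb I c) g q)"
        by (simp add: regular_on_iff)
      from regular_identity[OF ssd f this I] show ?L
        using \<open>?R\<close> by (simp add: linear_star_same_slice[OF I])
    qed (use linear_star_same_slice[OF I] in auto)
    then show ?thesis by (auto simp: regular_product_linear[OF ssd])
  qed
  have "\<exists>!g. ?P g"
    unfolding P_iff
  proof (rule ex_ex1I)
    obtain J where J: "J \<in> \<SS>" "orthogonal I J" using orthogonal_unit_exists[OF I] by blast
    have F: "left_holomorphic_on I ?D (\<lambda>z. f (emb I z))"
      using f I by (simp add: regular_on_iff o_def)
    define quot where "quot u z = (if z = c then deriv u c else (u z - u c) / (z - c))"
      for u :: "complex \<Rightarrow> complex" and z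
    have quot: "quot u holomorphic_on ?D" if "u holomorphic_on ?D" for u
      unfolding quot_def using pole_lemma[OF that, of c] c D by (simp add: interior_open)
    have quot_mult: "(z - c) * quot u z = u z - u c" for u z
      by (simp add: quot_def)
    let ?a = "\<lambda>z. proj I (f (emb I z))" and ?b = "\<lambda>z. - proj I (f (emb I z) * J)"
    define G where "G z = emb I (quot ?a z) + emb I (quot ?b z) * J" for z
    have "left_holomorphic_on I ?D G"
      unfolding G_def[abs_def]
      by (intro left_holomorphic_on_add left_holomorphic_on_mult_right left_holomorphic_on_emb_comp
          quot holomorphic_on_minus holomorphic_on_proj I F D)
    from regular_slice_extension[OF ssd I this]
    have reg: "regular_on \<Omega> (restrict (slice_extension I G) \<Omega>)"
      by (rule regular_on_cong) simp_all
    have "emb I (z - c) * G z = f (emb I z) - f (emb I c)" for z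
    proof -
      have "emb I (z - c) * G z = emb I ((z - c) * quot ?a z) + emb I ((z - c) * quot ?b z) * J"
        by (simp only: G_def emb_mult[OF I] distrib_left mult.assoc)
      also have "\<dots> = emb I (?a z - ?a c) + emb I (?b z - ?b c) * J"
        unfolding quot_mult ..
      also have "\<dots> = (emb I (?a z) + emb I (?b z) * J) - (emb I (?a c) + emb I (?b c) * J)"
        by (simp add: emb_simps algebra_simps)
      also have "\<dots> = f (emb I z) - f (emb I c)"
        by (simp only: slice_decomposition[OF I J, symmetric])
      finally show ?thesis .
    qed
    then show "\<exists>g. g \<in> extensional \<Omega> \<and> regular_on \<Omega> g \<and>
        (\<forall>z\<in>?D. f (emb I z) = f (emb I c) + emb I (z - c) * g (emb I z))"
      using reg by (intro exI[of _ "restrict (slice_extension I G) \<Omega>"])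
        (simp add: slice_extension_same_slice[OF I])
  next
    fix g h
    assume g: "g \<in> extensional \<Omega> \<and> regular_on \<Omega> g \<and>
        (\<forall>z\<in>?D. f (emb I z) = f (emb I c) + emb I (z - c) * g (emb I z))"
      and h: "h \<in> extensional \<Omega> \<and> regular_on \<Omega> h \<and>
        (\<forall>z\<in>?D. f (emb I z) = f (emb I c) + emb I (z - c) * h (emb I z))"
    have cont: "continuous_on ?D (\<lambda>z. u (emb I z))" if "regular_on \<Omega> u" for u
      using that I left_holomorphic_on_imp_continuous_on[of I ?D "u \<circ> emb I"]
      by (simp add: regular_on_iff o_def)
    have "g (emb I z) = h (emb I z)" if "emb I z \<in> \<Omega>" for z
    proof (rule continuous_on_eq_at_point[OF D, where a = c])
      fix w assume w: "w \<in> ?D" "w \<noteq> c"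
      then have "emb I (w - c) * g (emb I w) = emb I (w - c) * h (emb I w)"
        using g h by (metis add_left_cancel)
      moreover have "emb I (w - c) \<noteq> 0"
        using w norm_emb[OF I, of "w - c"] by auto
      ultimately show "g (emb I w) = h (emb I w)" by simp
    qed (use g h cont that in auto)
    then have "g q = h q" if "q \<in> \<Omega>" for q
      using regular_identity[OF ssd _ _ I _ that] g h by blast
    then show "g = h"
      using g h by (intro extensionalityI[of g \<Omega> h]) auto
  qed
  from theI'[OF this] have "?P (R_op \<Omega> (emb I c) f)" unfolding R_op_def .
  then show "regular_on \<Omega> (R_op \<Omega> (emb I c) f)"
    "emb I z \<in> \<Omega> \<Longrightarrow>
      f (emb I z) = f (emb I c) + emb I (z - c) * R_op \<Omega> (emb I c) f (emb I z)"
    unfolding P_iff by auto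
qed

section \<open>The expansion of regular functions\<close>

lemma U_nbhd_emb:
  assumes I: "I \<in> \<SS>"
  shows "(emb I z - of_real x0)\<^sup>2 + of_real (y0\<^sup>2) = emb I ((z - Complex x0 y0) * (z - cnj (Complex x0 y0)))"
    and "emb I z \<in> U_nbhd x0 y0 R \<longleftrightarrow> norm ((z - Complex x0 y0) * (z - cnj (Complex x0 y0))) < R\<^sup>2"
proof -
  have "(z - Complex x0 y0) * (z - cnj (Complex x0 y0)) = (z - of_real x0)\<^sup>2 + of_real (y0\<^sup>2)"
    by (simp add: complex_eq_iff power2_eq_square algebra_simps)
  then show eq: "(emb I z - of_real x0)\<^sup>2 + of_real (y0\<^sup>2) =
      emb I ((z - Complex x0 y0) * (z - cnj (Complex x0 y0)))"
    by (simp only: emb_simps emb_power[OF I])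
  show "emb I z \<in> U_nbhd x0 y0 R \<longleftrightarrow> norm ((z - Complex x0 y0) * (z - cnj (Complex x0 y0))) < R\<^sup>2"
    unfolding U_nbhd_def mem_Collect_eq eq norm_emb[OF I] ..
qed

text \<open>
  On the slice of the base point both components of \<open>f\<close> satisfy the hypotheses of
  \<open>two_point_expansion\<close>, with \<open>a = c\<close> and \<open>b = cnj c\<close>.
\<close>

lemma slice_expansion:
  assumes ssd: "symmetric_slice_domain \<Omega>" and f: "regular_on \<Omega> f"
    and U: "U_nbhd x0 y0 R \<subseteq> \<Omega>" and I: "I \<in> \<SS>"
    and zU: "emb I z \<in> U_nbhd x0 y0 R" and R: "R > 0"
  defines "c \<equiv> Complex x0 y0"
  defines "A0 \<equiv> \<lambda>n. RR_iter \<Omega> (emb I c) n f (emb I c)"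
    and "A1 \<equiv> \<lambda>n. R_op \<Omega> (emb I c) (RR_iter \<Omega> (emb I c) n f) (emb I (cnj c))"
  shows "(\<lambda>n. emb I (((z - c) * (z - cnj c)) ^ n) * (A0 n + emb I (z - c) * A1 n)) sums f (emb I z)"
proof -
  define F where "F n = RR_iter \<Omega> (emb I c) n f" for n
  define G where "G n = R_op \<Omega> (emb I c) (F n)" for n
  define V where "V = {z. norm ((z - c) * (z - cnj c)) < R\<^sup>2}"
  have V: "z \<in> V \<longleftrightarrow> emb I z \<in> U_nbhd x0 y0 R" for z
    unfolding V_def c_def mem_Collect_eq U_nbhd_emb(2)[OF I] ..
  then have V\<Omega>: "emb I z \<in> \<Omega>" if "z \<in> V" for z using U that by auto
  have c: "emb I c \<in> \<Omega>" "emb I (cnj c) \<in> \<Omega>"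
    using R by (auto intro!: V\<Omega> simp: V_def)
  have F0: "F 0 = f" by (simp add: F_def RR_iter_def)
  have FSuc: "F (Suc n) = R_op \<Omega> (emb I (cnj c)) (G n)" for n
    by (simp add: F_def G_def RR_iter_def qcnj_emb[OF I])
  have regF: "regular_on \<Omega> (F n)" for n
    by (induction n) (simp_all add: F0 f FSuc G_def R_op_slice(1)[OF ssd _ I] c)
  have regG: "regular_on \<Omega> (G n)" for n
    unfolding G_def by (rule R_op_slice(1)[OF ssd regF I c(1)])
  have FG: "F n (emb I z) = F n (emb I c) + emb I (z - c) * G n (emb I z)" if "z \<in> V" for n z
    unfolding G_def by (rule R_op_slice(2)[OF ssd regF I c(1) V\<Omega>[OF that]])
  have GF: "G n (emb I z) = G n (emb I (cnj c)) + emb I (z - cnj c) * F (Suc n) (emb I z)" if "z \<in> V" for n z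
    unfolding FSuc by (rule R_op_slice(2)[OF ssd regG I c(2) V\<Omega>[OF that]])
  have lh: "left_holomorphic_on I V (\<lambda>z. u (emb I z))" if "regular_on \<Omega> u" for u
    using that I V\<Omega> unfolding regular_on_iff o_def left_holomorphic_on_def by blast
  have comp: "(\<lambda>n. p (emb I (((z - c) * (z - cnj c)) ^ n) * (A0 n + emb I (z - c) * A1 n)))
      sums p (f (emb I z))"
    if p: "bounded_linear p" "\<And>w q. p (emb I w * q) = w * p q"
      and hol: "\<And>G. left_holomorphic_on I V G \<Longrightarrow> (\<lambda>z. p (G z)) holomorphic_on V"
    for p :: "quat \<Rightarrow> complex"
  proof -
    interpret p: bounded_linear p by (rule p(1))
    note hol' = hol[OF lh]
    have "(\<lambda>n. ((z - c) * (z - cnj c)) ^ n * (p (F n (emb I c)) + (z - c) * p (G n (emb I (cnj c)))))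
      sums p (F 0 (emb I z))"
    proof (rule two_point_expansion[of "\<lambda>n z. p (F n (emb I z))" c "cnj c" "R\<^sup>2" "\<lambda>n z. p (G n (emb I z))",
          folded V_def])
      show "p (F n (emb I z)) = p (F n (emb I c)) + (z - c) * p (G n (emb I z))" if "z \<in> V" for n z
        unfolding FG[OF that, of n] p.add p(2) ..
      show "p (G n (emb I z)) = p (G n (emb I (cnj c))) + (z - cnj c) * p (F (Suc n) (emb I z))"
        if "z \<in> V" for n z
        unfolding GF[OF that, of n] p.add p(2) ..
    qed (use zU V in \<open>auto intro!: hol' holomorphic_on_imp_continuous_on[OF hol'] regF regG\<close>)
    then show ?thesis
      by (simp add: p.add p(2) A0_def A1_def F_def G_def RR_iter_def)
  qed
  obtain J where J: "J \<in> \<SS>" "orthogonal I J" using orthogonal_unit_exists[OF I] by blast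
  let ?t = "\<lambda>n. emb I (((z - c) * (z - cnj c)) ^ n) * (A0 n + emb I (z - c) * A1 n)"
  have "(\<lambda>n. proj I (?t n)) sums proj I (f (emb I z))"
    by (rule comp[OF bounded_linear_proj proj_emb_mult[OF I] holomorphic_on_proj[OF I]])
  moreover have "(\<lambda>n. - proj I (?t n * J)) sums - proj I (f (emb I z) * J)"
    by (intro comp bounded_linear_minus bounded_linear_compose[OF bounded_linear_proj bounded_linear_mult_left]
        holomorphic_on_minus holomorphic_on_proj[OF I] left_holomorphic_on_mult_right)
      (simp_all add: proj_emb_mult[OF I] mult.assoc)
  ultimately have "(\<lambda>n. emb I (proj I (?t n)) + emb I (- proj I (?t n * J)) * J) sums
      (emb I (proj I (f (emb I z))) + emb I (- proj I (f (emb I z) * J)) * J)"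
    by (intro sums_add sums_mult2 bounded_linear.sums[OF bounded_linear_emb])
  then show ?thesis
    unfolding slice_decomposition[OF I J, symmetric] .
qed

text \<open>
  With \<open>P(q) = (q - x0)\<^sup>2 + y0\<^sup>2\<close>, the \<open>n\<close>-th term is
  \<open>P(q)\<^sup>n (A (2 n) - q0 A (2 n + 1)) + P(q)\<^sup>n q A (2 n + 1)\<close>. Here the constants stand on the right of
  \<open>P(q)\<^sup>n\<close> and \<open>P(q)\<^sup>n q\<close>, which are polynomials in \<open>q\<close> with real coefficients. The representation
  formula for such terms is a direct computation, so the terms and the limit are transported
  from \<open>slice I\<close> to the slice of \<open>q\<close> by the same linear combination.
\<close>

theorem theorem4p1:
  fixes \<Omega> :: "quat set" and f :: "quat \<Rightarrow> quat" and x0 y0 R :: real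
    and q0 q :: quat and A :: "nat \<Rightarrow> quat"
  assumes "symmetric_slice_domain \<Omega>"
    and "regular_on \<Omega> f"
    and "R > 0"
    and "U_nbhd x0 y0 R \<subseteq> \<Omega>"
    and "q0 \<in> quat_sphere x0 y0"
    and "\<And>n. A (2 * n) = RR_iter \<Omega> q0 n f q0"
    and "\<And>n. A (2 * n + 1) = R_op \<Omega> q0 (RR_iter \<Omega> q0 n f) (qcnj q0)"
    and "q \<in> U_nbhd x0 y0 R"
  shows "(\<lambda>n. ((q - of_real x0)\<^sup>2 + of_real (y0\<^sup>2)) ^ n * (A (2 * n) + (q - q0) * A (2 * n + 1)))
    sums f q"
proof -
  define c where "c = Complex x0 y0"
  obtain I where I: "I \<in> \<SS>" and q0: "q0 = emb I c"
    using assms(5) by (auto simp: quat_sphere_eq c_def)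
  obtain J z where J: "J \<in> \<SS>" and q: "q = emb J z" by (rule emb_cases)
  define P where "P z = (z - c) * (z - cnj c)" for z
  have P_cnj: "P (cnj z) = cnj (P z)" by (simp add: P_def)
  have zU: "emb I z \<in> U_nbhd x0 y0 R" "emb I (cnj z) \<in> U_nbhd x0 y0 R"
    using assms(8) P_cnj unfolding q U_nbhd_emb(2)[OF I] U_nbhd_emb(2)[OF J] c_def[symmetric] P_def[symmetric]
    by simp_all
  have A: "A (2 * n) = RR_iter \<Omega> (emb I c) n f (emb I c)"
    "A (2 * n + 1) = R_op \<Omega> (emb I c) (RR_iter \<Omega> (emb I c) n f) (emb I (cnj c))" for n
    unfolding assms(6,7) q0 qcnj_emb[OF I] by (rule refl)+
  let ?t = "\<lambda>K z n. emb K (P z ^ n) * (A (2 * n) + (emb K z - q0) * A (2 * n + 1))"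
  let ?T = "\<lambda>u v. (1/2) *\<^sub>R (1 - J * I) * u + (1/2) *\<^sub>R (1 + J * I) * v"
  have I_sums: "?t I w sums f (emb I w)" if "emb I w \<in> U_nbhd x0 y0 R" for w
    using slice_expansion[OF assms(1,2,4) I that assms(3)]
    unfolding c_def[symmetric] A[symmetric] P_def q0 emb_simps .
  have "(\<lambda>n. ?T (?t I z n) (?t I (cnj z) n)) sums ?T (f (emb I z)) (f (emb I (cnj z)))"
    by (intro sums_add sums_mult I_sums zU)
  moreover have "?T (f (emb I z)) (f (emb I (cnj z))) = f q"
    unfolding q using assms(4,8) q by (intro representation_formula[OF assms(1,2) I J, symmetric]) auto
  moreover have "?T (?t I z n) (?t I (cnj z) n) = ?t J z n" for n
  proof -
    have transport: "?T (emb I w * a) (emb I (cnj w) * a) = emb J w * a" for w a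
    proof -
      have "(1 - J * I) * emb I w + (1 + J * I) * emb I (cnj w) = emb J w + emb J w"
        by (simp add: emb_altdef algebra_simps imag_unit_square[OF I])
      then have "?T (emb I w) (emb I (cnj w)) = emb J w"
        by (simp flip: scaleR_add_right scaleR_2)
      then show ?thesis by (metis distrib_right mult.assoc)
    qed
    have "?t K w n = emb K (P w ^ n) * (A (2 * n) - q0 * A (2 * n + 1)) + emb K (P w ^ n * w) * A (2 * n + 1)"
      if "K \<in> \<SS>" for K w
      by (simp add: emb_mult[OF that] distrib_left left_diff_distrib right_diff_distrib mult.assoc)
    note expand = this[OF I, of z] this[OF I, of "cnj z"] this[OF J, of z]
    have cnj_eq: "P (cnj z) ^ n = cnj (P z ^ n)" "P (cnj z) ^ n * cnj z = cnj (P z ^ n * z)"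
      by (simp_all add: P_cnj)
    show ?thesis
      unfolding expand unfolding cnj_eq unfolding transport[symmetric] by (simp add: distrib_left add_ac)
  qed
  ultimately have "?t J z sums f q" by simp
  then show ?thesis
    unfolding q U_nbhd_emb(1)[OF J] c_def[symmetric] P_def[symmetric] emb_power[OF J] .
qed

end
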